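(* Let $\Gamma$ be a row-finite digraph, $\mathbb F$ a field, and $L(\Gamma)$ the Leavitt path algebra of $\Gamma$ over $\mathbb F$. If $A$ is a finite dimensional quotient algebra of $L(\Gamma)$ then $$A\cong\bigoplus_{k=1}^m M_{n_k}(B_k),$$ where each $n_k$ is a positive integer and $B_k=\mathbb F[x]/(P_k(x))$ with $P_k(x)\in\mathbb F[x]$ non-constant and $P_k(0)=1$, for $k=1,2,\dots,m$.
   Context: A digraph $\Gamma=(V,E,s,t)$ has vertex set $V$, arrow set $E$ (possibly infinite) and source and target maps $s,t:E\to V$. It is row-finite if $s^{-1}(v)$ is finite for all $v\in V$. $L(\Gamma)$ is the (not necessarily unital) $\mathbb F$-algebra generated by $V\sqcup E\sqcup E^*$, where $E^*=\{e^*: e\in E\}$, $s(e^* )=t(e)$, $t(e^* )=s(e)$, subject to: (V) $vw=\delta_{v,w}v$ for $v,w\in V$; (E) $s(e)e=e=e\,t(e)$ for $e\in E\sqcup E^*$; (CK1) $e^*f=\delta_{e,f}\,t(e)$ for $e,f\in E$; (CK2) $v=\sum_{s(e)=v}ee^*$ for every $v\in V$ with $s^{-1}(v)\neq\emptyset$. $M_n(B)$ denotes the algebra of $n\times n$ matrices over $B$. The case $m=0$ ($A=0$) is the empty direct sum. *)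

theory Defs
  imports
    "HOL-Computational_Algebra.Polynomial"
    "HOL-Library.Poly_Mapping"
    "HOL-Library.FuncSet"
    "Graph_Theory.Digraph"
begin

section \<open>Not necessarily unital algebras over a field\<close>

text \<open>
  There is no unit in the signature. The scalars are the elements of a type \<open>'f\<close> of class
  \<open>field\<close>; the structure lives on an explicit carrier.
\<close>

record ('f, 'a) alg =
  alg_carrier :: "'a set"
  alg_zero :: 'a
  alg_add :: "'a \<Rightarrow> 'a \<Rightarrow> 'a"
  alg_mult :: "'a \<Rightarrow> 'a \<Rightarrow> 'a"
  alg_scale :: "'f \<Rightarrow> 'a \<Rightarrow> 'a"

definition alg_subspace :: "('f, 'a) alg \<Rightarrow> 'a set \<Rightarrow> bool" where
  "alg_subspace A W \<longleftrightarrow> W \<subseteq> alg_carrier A \<and> alg_zero A \<in> W \<and>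
     (\<forall>x\<in>W. \<forall>y\<in>W. alg_add A x y \<in> W) \<and> (\<forall>c. \<forall>x\<in>W. alg_scale A c x \<in> W)"

definition alg_span :: "('f, 'a) alg \<Rightarrow> 'a set \<Rightarrow> 'a set" where
  "alg_span A S = \<Inter>{W. alg_subspace A W \<and> S \<subseteq> W}"

definition finite_dimensional :: "('f, 'a) alg \<Rightarrow> bool" where
  "finite_dimensional A \<longleftrightarrow>
     (\<exists>S. finite S \<and> S \<subseteq> alg_carrier A \<and> alg_span A S = alg_carrier A)"

text \<open>Two-sided algebra ideals.\<close>

definition alg_ideal :: "('f, 'a) alg \<Rightarrow> 'a set \<Rightarrow> bool" where
  "alg_ideal A I \<longleftrightarrow> alg_subspace A I \<and>
     (\<forall>a\<in>alg_carrier A. \<forall>x\<in>I. alg_mult A a x \<in> I \<and> alg_mult A x a \<in> I)"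

definition alg_ideal_gen :: "('f, 'a) alg \<Rightarrow> 'a set \<Rightarrow> 'a set" where
  "alg_ideal_gen A R = \<Inter>{I. alg_ideal A I \<and> R \<subseteq> I}"

definition alg_coset :: "('f, 'a) alg \<Rightarrow> 'a set \<Rightarrow> 'a \<Rightarrow> 'a set" where
  "alg_coset A I a = {alg_add A a x | x. x \<in> I}"

text \<open>
  The quotient algebra. For an ideal \<open>I\<close> the cosets united in each operation are all equal, so
  that, for example, the product of the cosets of \<open>a\<close> and \<open>b\<close> is the coset of the product.
\<close>

definition alg_quotient :: "('f, 'a) alg \<Rightarrow> 'a set \<Rightarrow> ('f, 'a set) alg" where
  "alg_quotient A I = \<lparr>
     alg_carrier = alg_coset A I ` alg_carrier A,
     alg_zero = alg_coset A I (alg_zero A),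
     alg_add = (\<lambda>X Y. \<Union>x\<in>X. \<Union>y\<in>Y. alg_coset A I (alg_add A x y)),
     alg_mult = (\<lambda>X Y. \<Union>x\<in>X. \<Union>y\<in>Y. alg_coset A I (alg_mult A x y)),
     alg_scale = (\<lambda>c X. \<Union>x\<in>X. alg_coset A I (alg_scale A c x))\<rparr>"

definition alg_isomorphic :: "('f, 'a) alg \<Rightarrow> ('f, 'b) alg \<Rightarrow> bool" where
  "alg_isomorphic A B \<longleftrightarrow> (\<exists>\<phi>. bij_betw \<phi> (alg_carrier A) (alg_carrier B) \<and>
     (\<forall>x\<in>alg_carrier A. \<forall>y\<in>alg_carrier A.
        \<phi> (alg_add A x y) = alg_add B (\<phi> x) (\<phi> y) \<and>
        \<phi> (alg_mult A x y) = alg_mult B (\<phi> x) (\<phi> y)) \<and>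
     (\<forall>c. \<forall>x\<in>alg_carrier A. \<phi> (alg_scale A c x) = alg_scale B c (\<phi> x)))"

text \<open>
  The direct sum of \<open>A 0, \<dots>, A (m - 1)\<close>. Families are \<open>undefined\<close> outside the index set, so for
  \<open>m = 0\<close> there is exactly one of them, and the sum is the zero algebra.
\<close>

definition alg_direct_sum :: "nat \<Rightarrow> (nat \<Rightarrow> ('f, 'a) alg) \<Rightarrow> ('f, nat \<Rightarrow> 'a) alg" where
  "alg_direct_sum m A = \<lparr>
     alg_carrier = (\<Pi>\<^sub>E k\<in>{..<m}. alg_carrier (A k)),
     alg_zero = (\<lambda>k\<in>{..<m}. alg_zero (A k)),
     alg_add = (\<lambda>f g. \<lambda>k\<in>{..<m}. alg_add (A k) (f k) (g k)),
     alg_mult = (\<lambda>f g. \<lambda>k\<in>{..<m}. alg_mult (A k) (f k) (g k)),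
     alg_scale = (\<lambda>c f. \<lambda>k\<in>{..<m}. alg_scale (A k) c (f k))\<rparr>"

primrec alg_sum :: "('f, 'a) alg \<Rightarrow> (nat \<Rightarrow> 'a) \<Rightarrow> nat \<Rightarrow> 'a" where
  "alg_sum A f 0 = alg_zero A"
| "alg_sum A f (Suc n) = alg_add A (alg_sum A f n) (f n)"

text \<open>The algebra of \<open>n \<times> n\<close> matrices over \<open>B\<close>, with indices \<open>0, \<dots>, n - 1\<close>.\<close>

definition matrix_alg :: "nat \<Rightarrow> ('f, 'a) alg \<Rightarrow> ('f, nat \<times> nat \<Rightarrow> 'a) alg" where
  "matrix_alg n B = \<lparr>
     alg_carrier = {..<n} \<times> {..<n} \<rightarrow>\<^sub>E alg_carrier B,
     alg_zero = (\<lambda>ij\<in>{..<n} \<times> {..<n}. alg_zero B),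
     alg_add = (\<lambda>X Y. \<lambda>ij\<in>{..<n} \<times> {..<n}. alg_add B (X ij) (Y ij)),
     alg_mult = (\<lambda>X Y. \<lambda>(i, j)\<in>{..<n} \<times> {..<n}.
       alg_sum B (\<lambda>l. alg_mult B (X (i, l)) (Y (l, j))) n),
     alg_scale = (\<lambda>c X. \<lambda>ij\<in>{..<n} \<times> {..<n}. alg_scale B c (X ij))\<rparr>"

definition poly_alg :: "('f :: field, 'f poly) alg" where
  "poly_alg = \<lparr>alg_carrier = UNIV, alg_zero = 0, alg_add = (+), alg_mult = (*), alg_scale = smult\<rparr>"

text \<open>\<open>\<bbbF>[x]/(P)\<close>\<close>

definition poly_quotient_alg :: "'f :: field poly \<Rightarrow> ('f, 'f poly set) alg" where
  "poly_quotient_alg P = alg_quotient poly_alg (alg_ideal_gen poly_alg {P})"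


section \<open>Free algebras\<close>

text \<open>
  The free monoid, written additively so that the type of finitely supported functions on it,
  with its convolution product, is the free unital associative algebra on the letters.
\<close>

datatype 'x free_word = Word (letters: "'x list")

instantiation free_word :: (type) monoid_add
begin

definition zero_free_word :: "'a free_word" where "0 = Word []"

definition plus_free_word :: "'a free_word \<Rightarrow> 'a free_word \<Rightarrow> 'a free_word" where
  "u + v = Word (letters u @ letters v)"

instance
  by standard (auto simp: zero_free_word_def plus_free_word_def)

end

definition letter :: "'x \<Rightarrow> 'x free_word \<Rightarrow>\<^sub>0 'f :: field" where
  "letter x = Poly_Mapping.single (Word [x]) 1"

text \<open>The free non-unital algebra on \<open>X\<close> is spanned by the nonempty words over \<open>X\<close>.\<close>

definition free_alg :: "'x set \<Rightarrow> ('f :: field, 'x free_word \<Rightarrow>\<^sub>0 'f) alg" where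
  "free_alg X = \<lparr>
     alg_carrier = {p. \<forall>w\<in>Poly_Mapping.keys p. letters w \<noteq> [] \<and> set (letters w) \<subseteq> X},
     alg_zero = 0, alg_add = (+), alg_mult = (*),
     alg_scale = (\<lambda>c p. Poly_Mapping.single 0 c * p)\<rparr>"


section \<open>Leavitt path algebras\<close>

definition row_finite :: "('v, 'e) pre_digraph \<Rightarrow> bool" where
  "row_finite G \<longleftrightarrow> (\<forall>v\<in>verts G. finite (out_arcs G v))"

datatype ('v, 'e) lpa_gen = Vtx 'v | Arc 'e | Ghost 'e

definition lpa_gens :: "('v, 'e) pre_digraph \<Rightarrow> ('v, 'e) lpa_gen set" where
  "lpa_gens G = Vtx ` verts G \<union> Arc ` arcs G \<union> Ghost ` arcs G"

text \<open>
  The defining relations, each written as a difference of its two sides, in the order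
  (V), (E) for arrows, (E) for ghost arrows, (CK1), (CK2).
  \<open>Ghost e\<close> stands for \<open>e\<^sup>*\<close>, whose source is \<open>head G e\<close> and whose target is \<open>tail G e\<close>.
  The sum in (CK2) is meaningful because the digraph is assumed to be row-finite.
\<close>

definition lpa_rels ::
  "('v, 'e) pre_digraph \<Rightarrow> (('v, 'e) lpa_gen free_word \<Rightarrow>\<^sub>0 'f :: field) set" where
  "lpa_rels G =
     {letter (Vtx v) * letter (Vtx w) - (if v = w then letter (Vtx v) else 0) | v w.
        v \<in> verts G \<and> w \<in> verts G} \<union>
     (\<Union>e\<in>arcs G. {letter (Vtx (tail G e)) * letter (Arc e) - letter (Arc e),
                   letter (Arc e) * letter (Vtx (head G e)) - letter (Arc e)}) \<union>
     (\<Union>e\<in>arcs G. {letter (Vtx (head G e)) * letter (Ghost e) - letter (Ghost e),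
                   letter (Ghost e) * letter (Vtx (tail G e)) - letter (Ghost e)}) \<union>
     {letter (Ghost e) * letter (Arc f) - (if e = f then letter (Vtx (head G e)) else 0) | e f.
        e \<in> arcs G \<and> f \<in> arcs G} \<union>
     {letter (Vtx v) - (\<Sum>e\<in>out_arcs G v. letter (Arc e) * letter (Ghost e)) | v.
        v \<in> verts G \<and> out_arcs G v \<noteq> {}}"

text \<open>The ground field does not occur among the arguments: it is read off the result type.\<close>

definition leavitt_path_alg ::
  "('v, 'e) pre_digraph \<Rightarrow> ('f :: field, (('v, 'e) lpa_gen free_word \<Rightarrow>\<^sub>0 'f) set) alg" where
  "leavitt_path_alg G =
     alg_quotient (free_alg (lpa_gens G)) (alg_ideal_gen (free_alg (lpa_gens G)) (lpa_rels G))"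

end

theory Submission
  imports Defs
begin

text \<open>
  In a finite dimensional image \<open>A\<close> of a Leavitt path algebra only finitely many vertices are
  nonzero (live), and they sum to a unit. A left invertible element of a corner \<open>vAv\<close> is
  invertible, so no cycle of live vertices has a live exit. Choose a minimal set \<open>T\<close> of live
  vertices that contains the live sinks and meets every cycle. It then consists of the live sinks
  and one vertex of each cycle, and every live vertex is the sum of the \<open>pp\<^sup>*\<close> over the finitely
  many paths \<open>p\<close> from it that stop on first meeting \<open>T\<close>. The elements \<open>pq\<^sup>*\<close>, with \<open>p\<close> and \<open>q\<close> both
  ending at \<open>u \<in> T\<close>, are the matrix units of one block, whose entries lie in the corner \<open>uAu\<close>. This
  corner is generated by the cycle at \<open>u\<close> (or by \<open>u\<close> itself if \<open>u\<close> is a sink), an invertible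
  element, hence is \<open>\<bbbF>[x]/(P)\<close> with \<open>P(0) = 1\<close>.
\<close>

section \<open>Algebras without unit on a type\<close>

text \<open>The ideal need not be generated by vertices, so \<open>A\<close> is in general not the
  Leavitt path algebra of a smaller digraph: a cycle may satisfy a polynomial equation, and these
  equations are the origin of the \<open>P_k\<close>. Finite dimensionality enters only through
  products lying in the span of a finite set. This bounds the number of orthogonal idempotents and
  gives each corner element a minimal polynomial. A left inverse makes the constant term of that
  polynomial nonzero, and scaling it to 1 is the normalisation in the theorem. The inverse of the
  cycle is then itself a polynomial in the cycle, which is what allows the ghost of an arc on the
  cycle to be rewritten by a path. For a sink the vertex serves as its own cycle: \<open>P\<close>
  is \<open>1 - x\<close> and the block is a matrix algebra over the field. The hitting set stands
  in for a structure theory of the digraph: acyclicity off the set gives well-founded induction over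
  successors, minimality gives the cycles. Since cosets of cosets carry no type class structure, the
  argument runs on a copy of the quotient inside the type of the free algebra.\<close>

locale nonunital_algebra = vector_space scale
  for scale :: "'f::field \<Rightarrow> 'a::ab_group_add \<Rightarrow> 'a" +
  fixes mul :: "'a \<Rightarrow> 'a \<Rightarrow> 'a" (infixl "\<odot>" 70)
  assumes assoc: "(x \<odot> y) \<odot> z = x \<odot> (y \<odot> z)"
    and add_mul: "(x + y) \<odot> z = x \<odot> z + y \<odot> z"
    and mul_add: "x \<odot> (y + z) = x \<odot> y + x \<odot> z"
    and scale_mul: "scale c x \<odot> y = scale c (x \<odot> y)"
    and mul_scale: "x \<odot> scale c y = scale c (x \<odot> y)"
begin

lemma zero_mul [simp]: "0 \<odot> x = 0"
  using add_mul[of 0 0 x] by simp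

lemma mul_zero [simp]: "x \<odot> 0 = 0"
  using mul_add[of x 0 0] by simp

lemma uminus_mul: "(- x) \<odot> y = - (x \<odot> y)"
  using add_mul[of "- x" x y] by (simp add: eq_neg_iff_add_eq_0)

lemma mul_uminus: "x \<odot> (- y) = - (x \<odot> y)"
  using mul_add[of x "- y" y] by (simp add: eq_neg_iff_add_eq_0)

lemma diff_mul: "(x - y) \<odot> z = x \<odot> z - y \<odot> z"
  using add_mul[of x "- y" z] by (simp add: uminus_mul)

lemma mul_diff: "x \<odot> (y - z) = x \<odot> y - x \<odot> z"
  using mul_add[of x y "- z"] by (simp add: mul_uminus)

lemma sum_mul: "sum f A \<odot> x = (\<Sum>a\<in>A. f a \<odot> x)"
  by (induction A rule: infinite_finite_induct) (auto simp: add_mul)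

lemma mul_sum: "x \<odot> sum f A = (\<Sum>a\<in>A. x \<odot> f a)"
  by (induction A rule: infinite_finite_induct) (auto simp: mul_add)

lemma span_mul_left:
  assumes "x \<in> span S" and "\<And>d. d \<in> S \<Longrightarrow> a \<odot> d \<in> span S"
  shows "a \<odot> x \<in> span S"
  using assms(1)
proof (induction rule: span_induct_alt)
  case base
  then show ?case by (simp add: span_zero)
next
  case (step c y z)
  then show ?case using assms(2) by (simp add: mul_add mul_scale span_add span_scale)
qed

text \<open>\<open>u\<close> plays the part of the unit: \<open>ev u c p\<close> is the value of \<open>p\<close> at \<open>c\<close> in the corner of \<open>u\<close>.\<close>

definition ev :: "'a \<Rightarrow> 'a \<Rightarrow> 'f poly \<Rightarrow> 'a" where
  "ev u c p = fold_coeffs (\<lambda>a x. scale a u + c \<odot> x) p 0"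

lemma ev_0 [simp]: "ev u c 0 = 0"
  by (simp add: ev_def)

lemma ev_pCons [simp]: "ev u c (pCons a p) = scale a u + c \<odot> ev u c p"
  unfolding ev_def by (cases "a = 0 \<and> p = 0") auto

lemma ev_1 [simp]: "ev u c 1 = u"
  by (simp add: one_pCons)

lemma ev_add: "ev u c (p + q) = ev u c p + ev u c q"
  by (induction p q rule: poly_induct2) (auto simp: mul_add scale_left_distrib)

lemma ev_smult: "ev u c (smult a p) = scale a (ev u c p)"
  by (induction p) (auto simp: mul_scale scale_right_distrib)

lemma ev_uminus: "ev u c (- p) = - ev u c p"
  using ev_smult[of u c "-1" p] by simp

lemma ev_diff: "ev u c (p - q) = ev u c p - ev u c q"
  using ev_add[of u c p "- q"] by (simp add: ev_uminus)

lemma ev_sum: "ev u c (sum f A) = (\<Sum>a\<in>A. ev u c (f a))"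
  by (induction A rule: infinite_finite_induct) (auto simp: ev_add)

lemma ev_unit_left:
  assumes "u \<odot> u = u" "u \<odot> c = c"
  shows "u \<odot> ev u c p = ev u c p"
  by (cases p) (simp add: mul_add mul_scale assms assoc[symmetric])

lemma ev_unit_right:
  assumes "u \<odot> u = u" "c \<odot> u = c"
  shows "ev u c p \<odot> u = ev u c p"
  by (induction p) (simp_all add: add_mul scale_mul assms assoc)

lemma ev_mult:
  assumes "u \<odot> u = u" "u \<odot> c = c"
  shows "ev u c (p * q) = ev u c p \<odot> ev u c q"
  by (induction p)
    (simp_all add: mult_pCons_left ev_add ev_smult add_mul scale_mul ev_unit_left[OF assms] assoc)

text \<open>If no nonzero polynomial vanished at \<open>c\<close>, its powers would be infinitely
  many independent vectors in the span of a finite set.\<close>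

lemma ev_dependent:
  assumes "finite B" "\<And>p. ev u c p \<in> span B"
  obtains p where "p \<noteq> 0" "ev u c p = 0"
proof (rule ccontr)
  assume "\<not> thesis"
  then have triv: "p = 0" if "ev u c p = 0" for p
    using that \<open>\<And>p. p \<noteq> 0 \<Longrightarrow> ev u c p = 0 \<Longrightarrow> thesis\<close> by blast
  define w where "w = (\<lambda>i::nat. ev u c (monom 1 i))"
  have inj_w: "inj w"
  proof (rule injI)
    fix i j assume "w i = w j"
    then have "ev u c (monom 1 i - monom 1 j) = 0" by (simp add: w_def ev_diff)
    then have "monom (1::'f) i = monom 1 j" using triv by fastforce
    then show "i = j" by (metis degree_monom_eq one_neq_zero)
  qed
  have "independent (range w)"
    unfolding independent_explicit_module
  proof (intro allI impI)
    fix t k v assume t: "finite t" "t \<subseteq> range w" "(\<Sum>v\<in>t. scale (k v) v) = 0" "v \<in> t"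
    obtain I where I: "finite I" "t = w ` I" using t finite_subset_image[of t w UNIV] by blast
    have "(\<Sum>v\<in>t. scale (k v) v) = (\<Sum>i\<in>I. scale (k (w i)) (w i))"
      unfolding I by (subst sum.reindex) (use inj_w in \<open>auto simp: inj_on_def\<close>)
    also have "\<dots> = ev u c (\<Sum>i\<in>I. monom (k (w i)) i)"
      by (simp add: ev_sum w_def smult_monom flip: ev_smult)
    finally have "(\<Sum>i\<in>I. monom (k (w i)) i) = 0" using triv t by simp
    moreover obtain i where i: "i \<in> I" "v = w i" using t I by auto
    moreover have "coeff (\<Sum>i\<in>I. monom (k (w i)) i) i = k (w i)"
      using i I by (simp add: coeff_sum)
    ultimately show "k v = 0" by simp
  qed
  moreover have "range w \<subseteq> span B" using assms(2) by (auto simp: w_def)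
  ultimately have "finite (range w)" using independent_span_bound[OF assms(1)] by blast
  then show False using inj_w finite_imageD infinite_UNIV_nat by blast
qed

text \<open>
  Left invertibility of \<open>c\<close> allows the minimal polynomial to be scaled to constant term 1, which
  expresses \<open>u\<close> as \<open>c\<close> times a polynomial in \<open>c\<close>.
\<close>

lemma left_invertible_corner:
  assumes B: "finite B" "\<And>x y. x \<odot> y \<in> span B"
    and u: "u \<odot> u = u" "u \<noteq> 0" and c: "u \<odot> c = c" "c \<odot> u = c"
    and s: "s \<odot> u = s" "s \<odot> c = u"
  obtains P Q where "poly P 0 = 1" "degree P > 0" "\<And>q. ev u c q = 0 \<longleftrightarrow> P dvd q"
    "s = ev u c Q" "c \<odot> s = u"
proof -
  have evB: "ev u c p \<in> span B" for p
    using B(2)[of u "ev u c p"] ev_unit_left[OF u(1) c(1)] by simp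
  obtain p0 where "p0 \<noteq> 0 \<and> ev u c p0 = 0" using ev_dependent[OF B(1) evB] by metis
  then obtain p where p: "p \<noteq> 0" "ev u c p = 0"
    and least: "\<And>q. q \<noteq> 0 \<Longrightarrow> ev u c q = 0 \<Longrightarrow> degree p \<le> degree q"
    using arg_min_nat_lemma[of "\<lambda>p. p \<noteq> 0 \<and> ev u c p = 0" p0 degree] by blast
  note mult = ev_mult[OF u(1) c(1)]
  \<comment> \<open>If \<open>p\<close> were \<open>x * q\<close>, multiplying by \<open>s\<close>
    would cancel \<open>c\<close>, and \<open>q\<close>, of smaller degree, would vanish at
    \<open>c\<close> too.\<close>
  have p0: "coeff p 0 \<noteq> 0"
  proof
    assume "coeff p 0 = 0"
    then obtain q where q: "p = pCons 0 q" by (cases p) auto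
    have "ev u c q = s \<odot> ev u c p"
      by (simp add: q s assoc[symmetric] ev_unit_left[OF u(1) c(1)])
    then have "ev u c q = 0" by (simp add: p)
    moreover have "q \<noteq> 0" using p q by auto
    ultimately show False using least[of q] q by simp
  qed
  define P where "P = smult (1 / coeff p 0) p"
  have P1: "coeff P 0 = 1" using p0 by (simp add: P_def)
  have evP: "ev u c P = 0" by (simp add: P_def ev_smult p)
  have degP: "degree P = degree p" using p0 by (simp add: P_def)
  have dvd: "ev u c q = 0 \<longleftrightarrow> P dvd q" for q
  proof
    assume q: "ev u c q = 0"
    have "ev u c (q mod P) = 0"
      using mult[of P "q div P"] ev_add[of u c "P * (q div P)" "q mod P"] by (simp add: q evP)
    then have "q mod P = 0 \<or> degree P \<le> degree (q mod P)" using least degP by auto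
    moreover have "P \<noteq> 0" using P1 by auto
    ultimately show "P dvd q" using degree_mod_less[of P q] by (auto simp: mod_eq_0_iff_dvd)
  next
    assume "P dvd q"
    then show "ev u c q = 0" by (auto simp: mult evP)
  qed
  obtain R where R: "P = pCons 1 R" using P1 by (cases P) auto
  \<comment> \<open>\<open>P = 1 + x * R\<close> vanishes at \<open>c\<close>, so \<open>- R\<close>
    gives a right inverse of \<open>c\<close>; multiplication by \<open>s\<close> identifies it with
    \<open>s\<close>.\<close>
  have uR: "u = c \<odot> ev u c (- R)"
    using evP by (simp add: R ev_uminus mul_uminus eq_neg_iff_add_eq_0)
  then have "s \<odot> u = s \<odot> (c \<odot> ev u c (- R))" by simp
  then have sR: "s = ev u c (- R)"
    by (simp add: s assoc[symmetric] ev_unit_left[OF u(1) c(1)])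
  have "degree P > 0"
  proof (rule ccontr)
    assume "\<not> degree P > 0"
    then have "R = 0" by (simp add: R split: if_splits)
    then show False using evP u(2) by (simp add: R)
  qed
  moreover have "poly P 0 = 1" using P1 by (simp add: poly_0_coeff_0)
  ultimately show ?thesis using that dvd sR uR by metis
qed

text \<open>Multiplying a linear relation by one of the idempotents isolates its coefficient, so
  they are independent; being their own squares, they lie in \<open>span B\<close>.\<close>

lemma finite_orthogonal_idempotents:
  assumes B: "finite B" "\<And>x y. x \<odot> y \<in> span B"
    and a: "\<And>i. i \<in> I \<Longrightarrow> a i \<noteq> 0" "\<And>i. i \<in> I \<Longrightarrow> a i \<odot> a i = a i"
    and orth: "\<And>i j. i \<in> I \<Longrightarrow> j \<in> I \<Longrightarrow> i \<noteq> j \<Longrightarrow> a i \<odot> a j = 0"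
  shows "finite I"
proof -
  have inj: "inj_on a I" by (rule inj_onI) (metis a orth)
  have "independent (a ` I)"
    unfolding independent_explicit_module
  proof (intro allI impI)
    fix t k v assume t: "finite t" "t \<subseteq> a ` I" "(\<Sum>v\<in>t. scale (k v) v) = 0" "v \<in> t"
    have "v \<odot> w = (if w = v then v else 0)" if "w \<in> t" for w
      using that t a orth by (smt (verit) image_iff subsetD)
    then have "v \<odot> (\<Sum>w\<in>t. scale (k w) w) = (\<Sum>w\<in>t. if w = v then scale (k v) v else 0)"
      by (auto simp: mul_sum mul_scale intro!: sum.cong)
    also have "\<dots> = scale (k v) v" using t by simp
    finally have "scale (k v) v = 0" using t by simp
    moreover have "v \<noteq> 0" using t a by auto
    ultimately show "k v = 0" by simp
  qed
  moreover have "a ` I \<subseteq> span B"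
  proof
    fix x assume "x \<in> a ` I"
    then show "x \<in> span B" using a(2) B(2) by (metis imageE)
  qed
  ultimately have "finite (a ` I)" using independent_span_bound[OF B(1)] by blast
  then show ?thesis using inj finite_imageD by blast
qed

end

section \<open>Isomorphisms of algebras\<close>

definition alg_closed :: "('f, 'a) alg \<Rightarrow> bool" where
  "alg_closed A \<longleftrightarrow> alg_zero A \<in> alg_carrier A \<and>
     (\<forall>x\<in>alg_carrier A. \<forall>y\<in>alg_carrier A.
        alg_add A x y \<in> alg_carrier A \<and> alg_mult A x y \<in> alg_carrier A) \<and>
     (\<forall>c. \<forall>x\<in>alg_carrier A. alg_scale A c x \<in> alg_carrier A)"

definition alg_iso :: "('a \<Rightarrow> 'b) \<Rightarrow> ('f, 'a) alg \<Rightarrow> ('f, 'b) alg \<Rightarrow> bool" where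
  "alg_iso \<phi> A B \<longleftrightarrow> bij_betw \<phi> (alg_carrier A) (alg_carrier B) \<and>
     (\<forall>x\<in>alg_carrier A. \<forall>y\<in>alg_carrier A.
        \<phi> (alg_add A x y) = alg_add B (\<phi> x) (\<phi> y) \<and>
        \<phi> (alg_mult A x y) = alg_mult B (\<phi> x) (\<phi> y)) \<and>
     (\<forall>c. \<forall>x\<in>alg_carrier A. \<phi> (alg_scale A c x) = alg_scale B c (\<phi> x))"

lemma alg_isomorphic_iff: "alg_isomorphic A B \<longleftrightarrow> (\<exists>\<phi>. alg_iso \<phi> A B)"
  by (simp add: alg_isomorphic_def alg_iso_def)

lemma alg_isoD:
  assumes "alg_iso \<phi> A B"
  shows "bij_betw \<phi> (alg_carrier A) (alg_carrier B)"
    and "\<lbrakk>x \<in> alg_carrier A; y \<in> alg_carrier A\<rbrakk> \<Longrightarrow> \<phi> (alg_add A x y) = alg_add B (\<phi> x) (\<phi> y)"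
    and "\<lbrakk>x \<in> alg_carrier A; y \<in> alg_carrier A\<rbrakk> \<Longrightarrow> \<phi> (alg_mult A x y) = alg_mult B (\<phi> x) (\<phi> y)"
    and "x \<in> alg_carrier A \<Longrightarrow> \<phi> (alg_scale A c x) = alg_scale B c (\<phi> x)"
  using assms by (auto simp: alg_iso_def)

text \<open>Both given maps start at \<open>C\<close>, so one of them has to be inverted. Closure of
  \<open>C\<close> is what makes the inverse compatible with the operations.\<close>

lemma alg_isomorphic_from_common:
  assumes closed: "alg_closed C" and f: "alg_iso \<phi> C A" and g: "alg_iso \<psi> C B"
  shows "alg_isomorphic A B"
proof -
  let ?i = "inv_into (alg_carrier C) \<phi>"
  have bij: "bij_betw ?i (alg_carrier A) (alg_carrier C)"
    using alg_isoD(1)[OF f] by (rule bij_betw_inv_into)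
  have i: "?i x \<in> alg_carrier C" "\<phi> (?i x) = x" if "x \<in> alg_carrier A" for x
    using that bij alg_isoD(1)[OF f]
    by (auto simp: bij_betw_inv_into_right bij_betw_apply)
  have inv: "?i (\<phi> z) = z" if "z \<in> alg_carrier C" for z
    using that alg_isoD(1)[OF f] by (simp add: bij_betw_inv_into_left)
  have "alg_iso (\<psi> \<circ> ?i) A B"
    unfolding alg_iso_def
  proof (intro conjI ballI allI)
    show "bij_betw (\<psi> \<circ> ?i) (alg_carrier A) (alg_carrier B)"
      using bij alg_isoD(1)[OF g] by (rule bij_betw_trans)
  next
    fix x y assume x: "x \<in> alg_carrier A" and y: "y \<in> alg_carrier A"
    have "?i (alg_add A x y) = alg_add C (?i x) (?i y)"
      using inv[of "alg_add C (?i x) (?i y)"] alg_isoD(2)[OF f i(1)[OF x] i(1)[OF y]] i x y closed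
      by (simp add: alg_closed_def)
    then show "(\<psi> \<circ> ?i) (alg_add A x y) = alg_add B ((\<psi> \<circ> ?i) x) ((\<psi> \<circ> ?i) y)"
      using alg_isoD(2)[OF g] i x y by simp
    have "?i (alg_mult A x y) = alg_mult C (?i x) (?i y)"
      using inv[of "alg_mult C (?i x) (?i y)"] alg_isoD(3)[OF f i(1)[OF x] i(1)[OF y]] i x y closed
      by (simp add: alg_closed_def)
    then show "(\<psi> \<circ> ?i) (alg_mult A x y) = alg_mult B ((\<psi> \<circ> ?i) x) ((\<psi> \<circ> ?i) y)"
      using alg_isoD(3)[OF g] i x y by simp
  next
    fix c x assume x: "x \<in> alg_carrier A"
    have "?i (alg_scale A c x) = alg_scale C c (?i x)"
      using inv[of "alg_scale C c (?i x)"] alg_isoD(4)[OF f i(1)[OF x]] i x closed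
      by (simp add: alg_closed_def)
    then show "(\<psi> \<circ> ?i) (alg_scale A c x) = alg_scale B c ((\<psi> \<circ> ?i) x)"
      using alg_isoD(4)[OF g] i x by simp
  qed
  then show ?thesis by (auto simp: alg_isomorphic_iff)
qed

text \<open>Operations of \<open>alg_quotient\<close> are unions over representatives;
  well-definedness makes all the united sets equal.\<close>

lemma UN_constant_value: "A \<noteq> {} \<Longrightarrow> (\<And>a. a \<in> A \<Longrightarrow> f a = c) \<Longrightarrow> (\<Union>a\<in>A. f a) = c"
  by auto

text \<open>First isomorphism theorem, with the map sending a value to its fibre, so that no
  representatives are chosen. The second claim records the zero, about which \<open>alg_iso\<close>
  says nothing.\<close>

lemma quotient_fibres:
  assumes closed: "alg_closed A"
    and coset: "\<And>a. a \<in> alg_carrier A \<Longrightarrow> alg_coset A I a = {b \<in> alg_carrier A. h b = h a}"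
    and add: "\<And>a b. \<lbrakk>a \<in> alg_carrier A; b \<in> alg_carrier A\<rbrakk> \<Longrightarrow> h (alg_add A a b) = alg_add D (h a) (h b)"
    and mult: "\<And>a b. \<lbrakk>a \<in> alg_carrier A; b \<in> alg_carrier A\<rbrakk> \<Longrightarrow> h (alg_mult A a b) = alg_mult D (h a) (h b)"
    and scale: "\<And>c a. a \<in> alg_carrier A \<Longrightarrow> h (alg_scale A c a) = alg_scale D c (h a)"
    and onto: "h ` alg_carrier A = alg_carrier D"
  shows "alg_iso (\<lambda>y. {a \<in> alg_carrier A. h a = y}) D (alg_quotient A I)"
    and "{a \<in> alg_carrier A. h a = h (alg_zero A)} = alg_zero (alg_quotient A I)"
proof -
  let ?f = "\<lambda>y. {a \<in> alg_carrier A. h a = y}"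
  have nonempty: "?f y \<noteq> {}" if "y \<in> alg_carrier D" for y
    using that by (auto simp flip: onto)
  have "bij_betw ?f (alg_carrier D) (alg_carrier (alg_quotient A I))"
    unfolding bij_betw_def
  proof
    show "inj_on ?f (alg_carrier D)" using nonempty by (fastforce simp: inj_on_def)
    show "?f ` alg_carrier D = alg_carrier (alg_quotient A I)"
      using coset by (auto simp: alg_quotient_def image_image simp flip: onto)
  qed
  moreover have "?f (alg_add D y z) = alg_add (alg_quotient A I) (?f y) (?f z) \<and>
      ?f (alg_mult D y z) = alg_mult (alg_quotient A I) (?f y) (?f z)"
    if "y \<in> alg_carrier D" "z \<in> alg_carrier D" for y z
  proof -
    have "alg_coset A I (alg_add A a b) = ?f (alg_add D y z)"
      "alg_coset A I (alg_mult A a b) = ?f (alg_mult D y z)" if "a \<in> ?f y" "b \<in> ?f z" for a b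
      using that closed coset add mult by (auto simp: alg_closed_def)
    then have "(\<Union>a\<in>?f y. \<Union>b\<in>?f z. alg_coset A I (alg_add A a b)) = ?f (alg_add D y z)"
      "(\<Union>a\<in>?f y. \<Union>b\<in>?f z. alg_coset A I (alg_mult A a b)) = ?f (alg_mult D y z)"
      by (intro UN_constant_value[OF nonempty] that; blast)+
    then show ?thesis by (simp only: alg_quotient_def alg.select_convs)
  qed
  moreover have "?f (alg_scale D c y) = alg_scale (alg_quotient A I) c (?f y)"
    if "y \<in> alg_carrier D" for c y
  proof -
    have "alg_coset A I (alg_scale A c a) = ?f (alg_scale D c y)" if "a \<in> ?f y" for a
      using that closed coset scale by (auto simp: alg_closed_def)
    then have "(\<Union>a\<in>?f y. alg_coset A I (alg_scale A c a)) = ?f (alg_scale D c y)"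
      by (intro UN_constant_value[OF nonempty] that)
    then show ?thesis by (simp only: alg_quotient_def alg.select_convs)
  qed
  ultimately show "alg_iso ?f D (alg_quotient A I)" by (simp add: alg_iso_def)
  show "?f (h (alg_zero A)) = alg_zero (alg_quotient A I)"
    using closed coset by (simp add: alg_quotient_def alg_closed_def)
qed

lemma alg_ideal_gen_ideal:
  assumes "alg_ideal A (alg_carrier A)" "R \<subseteq> alg_carrier A"
  shows "alg_ideal A (alg_ideal_gen A R)"
proof -
  have "alg_ideal_gen A R \<subseteq> alg_carrier A" using assms by (auto simp: alg_ideal_gen_def)
  then show ?thesis
    unfolding alg_ideal_def alg_subspace_def alg_ideal_gen_def by auto
qed

lemma alg_ideal_gen_poly: "alg_ideal_gen poly_alg {P} = {q. P dvd q}"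
proof
  have "alg_ideal poly_alg {q. P dvd q}"
    by (auto simp: alg_ideal_def alg_subspace_def poly_alg_def intro: dvd_smult)
  then show "alg_ideal_gen poly_alg {P} \<subseteq> {q. P dvd q}" by (auto simp: alg_ideal_gen_def)
  show "{q. P dvd q} \<subseteq> alg_ideal_gen poly_alg {P}"
    by (auto simp: alg_ideal_gen_def alg_ideal_def poly_alg_def mult.commute)
qed

lemma alg_sum_cong:
  "(\<And>l. l < n \<Longrightarrow> f l = g l) \<Longrightarrow> alg_sum B f n = alg_sum B g n"
  by (induction n) auto

context nonunital_algebra
begin

definition sub_alg :: "'a set \<Rightarrow> ('f, 'a) alg" where
  "sub_alg C = \<lparr>alg_carrier = C, alg_zero = 0, alg_add = (+), alg_mult = (\<odot>), alg_scale = scale\<rparr>"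

lemma sub_alg_simps [simp]: "alg_carrier (sub_alg C) = C" "alg_zero (sub_alg C) = 0"
  "alg_add (sub_alg C) = (+)" "alg_mult (sub_alg C) = (\<odot>)" "alg_scale (sub_alg C) = scale"
  by (simp_all add: sub_alg_def)

text \<open>Entries of a matrix product are \<open>alg_sum\<close>s, which start from
  \<open>alg_zero B\<close>; hence the separate hypothesis on the image of 0.\<close>

lemma iso_alg_sum:
  assumes "alg_iso \<theta> (sub_alg K) B" "\<theta> 0 = alg_zero B" "subspace K" "\<And>l. l < n \<Longrightarrow> f l \<in> K"
  shows "\<theta> (\<Sum>l<n. f l) = alg_sum B (\<lambda>l. \<theta> (f l)) n"
  using assms(4)
proof (induction n)
  case (Suc n)
  have "(\<Sum>l<n. f l) \<in> K" using Suc.prems assms(3) by (intro subspace_sum) auto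
  then have "\<theta> ((\<Sum>l<n. f l) + f n) = alg_add B (\<theta> (\<Sum>l<n. f l)) (\<theta> (f n))"
    using alg_isoD(2)[OF assms(1)] Suc.prems by simp
  then show ?case using Suc by simp
qed (simp add: assms)

text \<open>
  The \<open>r k i \<odot> s k j\<close> are matrix units for the \<open>k\<close>th block, whose entries lie in the corner \<open>K k\<close>
  with unit \<open>w k\<close>.
\<close>

lemma matrix_units_iso:
  fixes m :: nat and n :: "nat \<Rightarrow> nat" and r s :: "nat \<Rightarrow> nat \<Rightarrow> 'a"
    and Bk :: "nat \<Rightarrow> ('f, 'b) alg" and \<theta> :: "nat \<Rightarrow> 'a \<Rightarrow> 'b"
  assumes C: "subspace C" "\<And>x y. x \<odot> y \<in> C"
    and orth: "\<And>k i l j. \<lbrakk>k < m; i < n k; l < m; j < n l\<rbrakk> \<Longrightarrow>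
      s k i \<odot> r l j = (if k = l \<and> i = j then w k else 0)"
    and unit_left: "\<And>x. x \<in> C \<Longrightarrow> (\<Sum>k<m. \<Sum>i<n k. r k i \<odot> (s k i \<odot> x)) = x"
    and unit_right: "\<And>x. x \<in> C \<Longrightarrow> (\<Sum>k<m. \<Sum>i<n k. (x \<odot> r k i) \<odot> s k i) = x"
    and K: "\<And>k i j x. \<lbrakk>k < m; i < n k; j < n k; x \<in> C\<rbrakk> \<Longrightarrow> s k i \<odot> x \<odot> r k j \<in> K k"
    and off: "\<And>k i l j x. \<lbrakk>k < m; i < n k; l < m; j < n l; k \<noteq> l; x \<in> C\<rbrakk> \<Longrightarrow> s k i \<odot> x \<odot> r l j = 0"
    and subspace_K: "\<And>k. k < m \<Longrightarrow> subspace (K k)"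
    and w: "\<And>k y. \<lbrakk>k < m; y \<in> K k\<rbrakk> \<Longrightarrow> w k \<odot> y = y \<and> y \<odot> w k = y"
    and mul_K: "\<And>k y z. \<lbrakk>k < m; y \<in> K k; z \<in> K k\<rbrakk> \<Longrightarrow> y \<odot> z \<in> K k"
    and \<theta>: "\<And>k. k < m \<Longrightarrow> alg_iso (\<theta> k) (sub_alg (K k)) (Bk k)"
      "\<And>k. k < m \<Longrightarrow> \<theta> k 0 = alg_zero (Bk k)"
  shows "\<exists>\<Phi>. alg_iso \<Phi> (sub_alg C) (alg_direct_sum m (\<lambda>k. matrix_alg (n k) (Bk k)))"
proof -
  define \<Phi> where "\<Phi> x = (\<lambda>k\<in>{..<m}. \<lambda>(i, j)\<in>{..<n k} \<times> {..<n k}. \<theta> k (s k i \<odot> x \<odot> r k j))" for x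
  have \<theta>_mem: "\<theta> k y \<in> alg_carrier (Bk k)" if "k < m" "y \<in> K k" for k y
    using alg_isoD(1)[OF \<theta>(1)[OF that(1)]] that(2) by (auto dest: bij_betw_apply)
  have entry_add: "s k i \<odot> (x + y) \<odot> r k j = s k i \<odot> x \<odot> r k j + s k i \<odot> y \<odot> r k j" for k i j x y
    by (simp add: mul_add add_mul)
  \<comment> \<open>The decomposition of the unit is inserted between \<open>x\<close> and
    \<open>y\<close>; by \<open>off\<close> only the summands of block \<open>k\<close>
    survive.\<close>
  have entry_mul: "s k i \<odot> (x \<odot> y) \<odot> r k j = (\<Sum>l<n k. (s k i \<odot> x \<odot> r k l) \<odot> (s k l \<odot> y \<odot> r k j))"
    if k: "k < m" "i < n k" and x: "x \<in> C" and y: "y \<in> C" for k i j x y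
  proof -
    have "s k i \<odot> (x \<odot> y) \<odot> r k j = s k i \<odot> (x \<odot> (\<Sum>l<m. \<Sum>a<n l. r l a \<odot> (s l a \<odot> y))) \<odot> r k j"
      by (simp add: unit_left[OF y])
    also have "\<dots> = (\<Sum>l<m. \<Sum>a<n l. (s k i \<odot> x \<odot> r l a) \<odot> (s l a \<odot> y \<odot> r k j))"
      by (simp add: mul_sum sum_mul assoc)
    also have "\<dots> = (\<Sum>l<m. if l = k then \<Sum>a<n k. (s k i \<odot> x \<odot> r k a) \<odot> (s k a \<odot> y \<odot> r k j) else 0)"
      using k x by (intro sum.cong refl) (auto simp: off)
    also have "\<dots> = (\<Sum>a<n k. (s k i \<odot> x \<odot> r k a) \<odot> (s k a \<odot> y \<odot> r k j))" using k by simp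
    finally show ?thesis .
  qed
  have inj: "inj_on \<Phi> C"
  proof (rule inj_onI)
    fix x y assume x: "x \<in> C" and y: "y \<in> C" and eq: "\<Phi> x = \<Phi> y"
    define d where "d = x - y"
    have d: "d \<in> C" using x y C(1) by (simp add: d_def subspace_diff)
    have entry: "s k i \<odot> d \<odot> r k j = 0" if "k < m" "i < n k" "j < n k" for k i j
    proof -
      have "\<Phi> x k (i, j) = \<Phi> y k (i, j)" by (simp add: eq)
      then have "\<theta> k (s k i \<odot> x \<odot> r k j) = \<theta> k (s k i \<odot> y \<odot> r k j)" using that by (simp add: \<Phi>_def)
      then have "s k i \<odot> x \<odot> r k j = s k i \<odot> y \<odot> r k j"
        using alg_isoD(1)[OF \<theta>(1)[OF that(1)]] K that x y by (auto simp: bij_betw_def inj_on_def)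
      then show ?thesis by (simp add: d_def mul_diff diff_mul)
    qed
    \<comment> \<open>The two decompositions of the unit remove the outer factors in turn:
      \<open>unit_right\<close> removes \<open>r\<close>, then \<open>unit_left\<close> removes
      \<open>s\<close>.\<close>
    have "s k i \<odot> d = 0" if k: "k < m" "i < n k" for k i
    proof -
      have "(s k i \<odot> d) \<odot> r l j = 0" if "l < m" "j < n l" for l j
        using entry off k that d by (cases "k = l") auto
      then have "(\<Sum>l<m. \<Sum>j<n l. ((s k i \<odot> d) \<odot> r l j) \<odot> s l j) = 0" by simp
      then show ?thesis using unit_right[OF C(2)[of "s k i" d]] by simp
    qed
    then have "(\<Sum>k<m. \<Sum>i<n k. r k i \<odot> (s k i \<odot> d)) = 0" by simp
    then show "x = y" using unit_left[OF d] by (simp add: d_def)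
  qed
  have "\<Phi> ` C = alg_carrier (alg_direct_sum m (\<lambda>k. matrix_alg (n k) (Bk k)))" (is "_ = ?M")
  proof
    show "\<Phi> ` C \<subseteq> ?M"
      using \<theta>_mem K by (auto simp: \<Phi>_def alg_direct_sum_def matrix_alg_def split: if_splits)
    show "?M \<subseteq> \<Phi> ` C"
    proof
      fix M assume M: "M \<in> ?M"
      define b where "b k i j = inv_into (K k) (\<theta> k) (M k (i, j))" for k i j
      have b: "b k i j \<in> K k" "\<theta> k (b k i j) = M k (i, j)" if "k < m" "i < n k" "j < n k" for k i j
      proof -
        have "M \<in> (\<Pi>\<^sub>E k\<in>{..<m}. alg_carrier (matrix_alg (n k) (Bk k)))"
          using M by (simp add: alg_direct_sum_def)
        then have "M k \<in> alg_carrier (matrix_alg (n k) (Bk k))"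
          using PiE_mem[of M "{..<m}" _ k] that(1) by blast
        then have "M k \<in> {..<n k} \<times> {..<n k} \<rightarrow>\<^sub>E alg_carrier (Bk k)"
          by (simp add: matrix_alg_def)
        then have "M k (i, j) \<in> alg_carrier (Bk k)"
          using PiE_mem[of "M k" "{..<n k} \<times> {..<n k}" _ "(i, j)"] that(2,3) by blast
        then have "M k (i, j) \<in> \<theta> k ` K k"
          using alg_isoD(1)[OF \<theta>(1)[OF that(1)]] by (simp add: bij_betw_def)
        then show "b k i j \<in> K k" "\<theta> k (b k i j) = M k (i, j)"
          by (auto simp: b_def inv_into_into f_inv_into_f)
      qed
      \<comment> \<open>The preimage of \<open>M\<close>: each entry, lifted along
        \<open>\<theta> k\<close>, is put at its matrix unit.\<close>
      define x where "x = (\<Sum>k<m. \<Sum>i<n k. \<Sum>j<n k. r k i \<odot> b k i j \<odot> s k j)"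
      have x: "x \<in> C" unfolding x_def using C by (intro subspace_sum) auto
      have "s l i' \<odot> x \<odot> r l j' = b l i' j'" if l: "l < m" "i' < n l" "j' < n l" for l i' j'
      proof -
        have entry: "s l i' \<odot> (r k i \<odot> b k i j \<odot> s k j) \<odot> r l j' =
            (if j = j' then if k = l \<and> i = i' then b l i' j' else 0 else 0)"
          if "k < m" "i < n k" "j < n k" for k i j
        proof -
          have "s l i' \<odot> (r k i \<odot> b k i j \<odot> s k j) \<odot> r l j' =
              (s l i' \<odot> r k i) \<odot> b k i j \<odot> (s k j \<odot> r l j')" by (simp add: assoc)
          then show ?thesis using orth w b that l by auto
        qed
        have "s l i' \<odot> x \<odot> r l j' =
            (\<Sum>k<m. \<Sum>i<n k. \<Sum>j<n k. s l i' \<odot> (r k i \<odot> b k i j \<odot> s k j) \<odot> r l j')"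
          by (simp add: x_def mul_sum sum_mul)
        also have "\<dots> = (\<Sum>k<m. \<Sum>i<n k. \<Sum>j<n k. if j = j' then if k = l \<and> i = i' then b l i' j' else 0 else 0)"
          by (intro sum.cong refl) (simp add: entry)
        also have "\<dots> = (\<Sum>k<m. if k = l then b l i' j' else 0)"
        proof (rule sum.cong[OF refl])
          fix k
          show "(\<Sum>i<n k. \<Sum>j<n k. if j = j' then if k = l \<and> i = i' then b l i' j' else 0 else 0) =
            (if k = l then b l i' j' else 0)" using l by (cases "k = l") (simp, auto intro!: sum.neutral)
        qed
        finally show ?thesis using l by simp
      qed
      then have "\<Phi> x k (i, j) = M k (i, j)" if "k < m" "i < n k" "j < n k" for k i j
        using that b by (simp add: \<Phi>_def)
      \<comment> \<open>Matrices and families are \<open>undefined\<close> off their index sets, so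
        agreement on the entries suffices.\<close>
      then have "\<Phi> x k = M k" if "k < m" for k
        using that M by (intro extensionalityI[of _ "{..<n k} \<times> {..<n k}"])
          (auto simp: \<Phi>_def alg_direct_sum_def matrix_alg_def PiE_def Pi_def)
      then have "\<Phi> x = M"
        using M by (intro extensionalityI[of _ "{..<m}"]) (auto simp: \<Phi>_def alg_direct_sum_def PiE_def)
      then show "M \<in> \<Phi> ` C" using x by blast
    qed
  qed
  then have "bij_betw \<Phi> C ?M" using inj by (simp add: bij_betw_def)
  moreover have "\<Phi> (x + y) = alg_add (alg_direct_sum m (\<lambda>k. matrix_alg (n k) (Bk k))) (\<Phi> x) (\<Phi> y)"
    if "x \<in> C" "y \<in> C" for x y
    using that K alg_isoD(2)[OF \<theta>(1)]
    by (auto simp: \<Phi>_def alg_direct_sum_def matrix_alg_def entry_add fun_eq_iff restrict_def)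
  moreover have "\<Phi> (x \<odot> y) = alg_mult (alg_direct_sum m (\<lambda>k. matrix_alg (n k) (Bk k))) (\<Phi> x) (\<Phi> y)"
    if x: "x \<in> C" and y: "y \<in> C" for x y
  proof -
    have "\<theta> k (s k i \<odot> (x \<odot> y) \<odot> r k j) =
        alg_sum (Bk k) (\<lambda>l. alg_mult (Bk k) (\<Phi> x k (i, l)) (\<Phi> y k (l, j))) (n k)"
      if k: "k < m" "i < n k" "j < n k" for k i j
    proof -
      have "\<theta> k (s k i \<odot> (x \<odot> y) \<odot> r k j) =
          alg_sum (Bk k) (\<lambda>l. \<theta> k ((s k i \<odot> x \<odot> r k l) \<odot> (s k l \<odot> y \<odot> r k j))) (n k)"
        unfolding entry_mul[OF k(1,2) x y]
        by (rule iso_alg_sum[OF \<theta>(1)[OF k(1)] \<theta>(2)[OF k(1)] subspace_K[OF k(1)]])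
          (use k x y K mul_K in auto)
      also have "\<dots> = alg_sum (Bk k) (\<lambda>l. alg_mult (Bk k) (\<Phi> x k (i, l)) (\<Phi> y k (l, j))) (n k)"
        using k x y K alg_isoD(3)[OF \<theta>(1)] by (intro alg_sum_cong) (simp add: \<Phi>_def)
      finally show ?thesis .
    qed
    then show ?thesis
      unfolding \<Phi>_def[of "x \<odot> y"]
      by (auto simp: alg_direct_sum_def matrix_alg_def fun_eq_iff restrict_def)
  qed
  moreover have "\<Phi> (scale c x) = alg_scale (alg_direct_sum m (\<lambda>k. matrix_alg (n k) (Bk k))) c (\<Phi> x)"
    if "x \<in> C" for c x
    using that K alg_isoD(4)[OF \<theta>(1)]
    by (auto simp: \<Phi>_def alg_direct_sum_def matrix_alg_def scale_mul mul_scale fun_eq_iff restrict_def)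
  ultimately have "alg_iso \<Phi> (sub_alg C) (alg_direct_sum m (\<lambda>k. matrix_alg (n k) (Bk k)))"
    by (simp add: alg_iso_def)
  then show ?thesis by blast
qed

end

section \<open>Finite dimensional images of Leavitt path algebras\<close>

text \<open>\<open>X\<close> gives the images of the generators and \<open>C\<close> is the image
  algebra. \<open>C_least\<close> is induction on words, letters being added on the left.
  \<open>mul_in_C\<close> holds for arbitrary factors because in the intended instance the product
  first reduces them into \<open>C\<close>.\<close>

locale leavitt_rep = nonunital_algebra scale mul + wf_digraph G
  for scale :: "'f::field \<Rightarrow> 'a::ab_group_add \<Rightarrow> 'a"
    and mul :: "'a \<Rightarrow> 'a \<Rightarrow> 'a" (infixl "\<odot>" 70)
    and G :: "('v, 'e) pre_digraph" +
  fixes X :: "('v, 'e) lpa_gen \<Rightarrow> 'a" and C :: "'a set" and B :: "'a set"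
  assumes row_finite: "row_finite G"
    and subspace_C: "subspace C"
    and mul_in_C: "x \<odot> y \<in> C"
    and C_least: "\<lbrakk>subspace W; \<And>g. g \<in> lpa_gens G \<Longrightarrow> X g \<in> W;
      \<And>g x. g \<in> lpa_gens G \<Longrightarrow> x \<in> W \<Longrightarrow> X g \<odot> x \<in> W\<rbrakk> \<Longrightarrow> C \<subseteq> W"
    and finite_B: "finite B"
    and C_span: "C \<subseteq> span B"
    and vertex_mul: "\<lbrakk>v \<in> verts G; w \<in> verts G\<rbrakk> \<Longrightarrow>
      X (Vtx v) \<odot> X (Vtx w) = (if v = w then X (Vtx v) else 0)"
    and tail_arc: "e \<in> arcs G \<Longrightarrow> X (Vtx (tail G e)) \<odot> X (Arc e) = X (Arc e)"
    and arc_head: "e \<in> arcs G \<Longrightarrow> X (Arc e) \<odot> X (Vtx (head G e)) = X (Arc e)"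
    and head_ghost: "e \<in> arcs G \<Longrightarrow> X (Vtx (head G e)) \<odot> X (Ghost e) = X (Ghost e)"
    and ghost_tail: "e \<in> arcs G \<Longrightarrow> X (Ghost e) \<odot> X (Vtx (tail G e)) = X (Ghost e)"
    and CK1: "\<lbrakk>e \<in> arcs G; f \<in> arcs G\<rbrakk> \<Longrightarrow>
      X (Ghost e) \<odot> X (Arc f) = (if e = f then X (Vtx (head G e)) else 0)"
    and CK2: "\<lbrakk>v \<in> verts G; out_arcs G v \<noteq> {}\<rbrakk> \<Longrightarrow>
      X (Vtx v) = (\<Sum>e\<in>out_arcs G v. X (Arc e) \<odot> X (Ghost e))"
begin

abbreviation "ver v \<equiv> X (Vtx v)"
abbreviation "ar e \<equiv> X (Arc e)"
abbreviation "gho e \<equiv> X (Ghost e)"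

lemma mul_in_span: "x \<odot> y \<in> span B"
  using mul_in_C C_span by blast

subsection \<open>The live part of the digraph\<close>

definition live :: "'v set" where
  "live = {v \<in> verts G. ver v \<noteq> 0}"

definition out :: "'v \<Rightarrow> 'e set" where
  "out v = {e \<in> out_arcs G v. head G e \<in> live}"

lemma liveD: "v \<in> live \<Longrightarrow> v \<in> verts G" "v \<in> live \<Longrightarrow> ver v \<noteq> 0"
  by (auto simp: live_def)

lemma outD: "e \<in> out v \<Longrightarrow> e \<in> arcs G" "e \<in> out v \<Longrightarrow> tail G e = v"
  "e \<in> out v \<Longrightarrow> head G e \<in> live"
  by (auto simp: out_def)

text \<open>The arc and its ghost both absorb the head as a factor, so a vanishing head kills
  them.\<close>

lemma dead_arc:
  assumes "e \<in> arcs G" "head G e \<notin> live"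
  shows "ar e = 0" "gho e = 0"
proof -
  have "ver (head G e) = 0" using assms by (simp add: live_def)
  then show "ar e = 0" "gho e = 0"
    using arc_head[OF assms(1)] head_ghost[OF assms(1)] mul_zero zero_mul by metis+
qed

text \<open>A vanishing tail would kill the arc, and with it \<open>gho e \<odot> ar e\<close>,
  which is the head. Liveness thus passes backwards along arcs.\<close>

lemma tail_live:
  assumes "e \<in> arcs G" "head G e \<in> live"
  shows "tail G e \<in> live" "e \<in> out (tail G e)"
proof -
  have "ver (tail G e) \<noteq> 0"
  proof
    assume "ver (tail G e) = 0"
    then have "ar e = 0" using tail_arc[OF assms(1)] by (metis zero_mul)
    then show False using CK1[of e e] assms liveD by auto
  qed
  then show "tail G e \<in> live" using assms by (simp add: live_def)
  show "e \<in> out (tail G e)" using assms by (simp add: out_def)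
qed

lemma ver_idem: "v \<in> live \<Longrightarrow> ver v \<odot> ver v = ver v"
  by (simp add: vertex_mul liveD)

lemma ver_orth: "v \<in> verts G \<Longrightarrow> w \<in> verts G \<Longrightarrow> v \<noteq> w \<Longrightarrow> ver v \<odot> ver w = 0"
  by (simp add: vertex_mul)

lemma finite_live: "finite live"
proof (rule finite_orthogonal_idempotents[of B live ver])
  show "finite B" by (rule finite_B)
qed (auto simp: mul_in_span vertex_mul liveD)

lemma finite_out: "v \<in> live \<Longrightarrow> finite (out v)"
  unfolding out_def using row_finite liveD(1)[of v] by (auto simp: row_finite_def simp del: in_out_arcs_conv)

lemma ver_expand:
  assumes "v \<in> live" "out v \<noteq> {}"
  shows "ver v = (\<Sum>e\<in>out v. ar e \<odot> gho e)"
proof -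
  have "finite (out_arcs G v)" using row_finite liveD(1)[OF assms(1)] by (simp add: row_finite_def)
  then have "(\<Sum>e\<in>out_arcs G v. ar e \<odot> gho e) = (\<Sum>e\<in>out v. ar e \<odot> gho e)"
    by (rule sum.mono_neutral_right) (auto simp: out_def dead_arc)
  moreover have "out_arcs G v \<noteq> {}" using assms(2) by (auto simp: out_def)
  ultimately show ?thesis using CK2 liveD(1)[OF assms(1)] by simp
qed

text \<open>As a relation on vertices, the live digraph is open to \<open>acyclic\<close>, closures
  and \<open>wf\<close>. Only the tail is required to be in \<open>S\<close>: a chain of
  \<open>fwd (live - T)\<close> may end in \<open>T\<close> but cannot continue from there.\<close>

definition fwd :: "'v set \<Rightarrow> ('v \<times> 'v) set" where
  "fwd S = {(v, head G e) | v e. v \<in> S \<and> e \<in> out v}"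

lemma fwd_mono: "S \<subseteq> S' \<Longrightarrow> fwd S \<subseteq> fwd S'"
  by (auto simp: fwd_def)

lemma finite_fwd: "S \<subseteq> live \<Longrightarrow> finite (fwd S)"
  by (rule finite_subset[of _ "live \<times> live"]) (auto simp: fwd_def finite_live dest: outD)

text \<open>\<open>r\<close> is the product of the arcs along a path from \<open>v\<close> to
  \<open>w\<close>, and \<open>s\<close> the product of their ghosts in reverse order.\<close>

lemma reach_elements:
  assumes "(v, w) \<in> (fwd live)\<^sup>*" "v \<in> live"
  shows "\<exists>r s. s \<odot> r = ver w \<and> ver v \<odot> r = r \<and> r \<odot> ver w = r \<and> s \<odot> ver v = s"
  using assms
proof (induction rule: converse_rtrancl_induct)
  case base
  then show ?case using ver_idem by blast
next
  case (step x y)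
  from step.hyps(1) obtain e where e: "e \<in> out x" "y = head G e" by (auto simp: fwd_def)
  have e': "e \<in> arcs G" "tail G e = x" "y \<in> live" using outD[OF e(1)] e by auto
  then obtain r s where rs: "s \<odot> r = ver w" "ver y \<odot> r = r" "r \<odot> ver w = r" "s \<odot> ver y = s"
    using step.IH by blast
  have "(s \<odot> gho e) \<odot> (ar e \<odot> r) = s \<odot> ((gho e \<odot> ar e) \<odot> r)" by (simp add: assoc)
  also have "\<dots> = ver w" using CK1[of e e] e' e rs by simp
  finally have "(s \<odot> gho e) \<odot> (ar e \<odot> r) = ver w" .
  moreover have "ver x \<odot> (ar e \<odot> r) = ar e \<odot> r"
    using tail_arc[OF e'(1)] e'(2) by (simp add: assoc[symmetric])
  moreover have "(ar e \<odot> r) \<odot> ver w = ar e \<odot> r" by (simp add: assoc rs)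
  moreover have "(s \<odot> gho e) \<odot> ver x = s \<odot> gho e" using ghost_tail[OF e'(1)] e'(2) by (simp add: assoc)
  ultimately show ?case by blast
qed

text \<open>
  An exit \<open>f\<close> of the cycle through \<open>e\<close> would make the cycle left invertible but not invertible in
  the corner of \<open>v\<close>.
\<close>

lemma cycle_no_exit:
  assumes v: "v \<in> live" and e: "e \<in> out v" and f: "f \<in> out v"
    and cyc: "(head G e, v) \<in> (fwd live)\<^sup>*"
  shows "f = e"
proof (rule ccontr)
  assume ne: "f \<noteq> e"
  have e': "e \<in> arcs G" "tail G e = v" "head G e \<in> live"
    and f': "f \<in> arcs G" "tail G f = v" "head G f \<in> live" using outD e f by auto
  obtain r s where rs: "s \<odot> r = ver v" "ver (head G e) \<odot> r = r" "r \<odot> ver v = r"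
    "s \<odot> ver (head G e) = s" using reach_elements[OF cyc e'(3)] by blast
  \<comment> \<open>The closed path that starts with \<open>e\<close>, and its ghost.\<close>
  define c s' where "c = ar e \<odot> r" "s' = s \<odot> gho e"
  have "s' \<odot> c = s \<odot> ((gho e \<odot> ar e) \<odot> r)" by (simp add: c_s'_def assoc)
  then have sc: "s' \<odot> c = ver v" using CK1[of e e] e' rs by simp
  have "ver v \<odot> c = c" using tail_arc[of e] e' by (simp add: c_s'_def assoc[symmetric])
  moreover have "c \<odot> ver v = c" by (simp add: c_s'_def assoc rs)
  moreover have "s' \<odot> ver v = s'" using ghost_tail[of e] e' by (simp add: c_s'_def assoc)
  ultimately have "c \<odot> s' = ver v"
    using left_invertible_corner[OF finite_B mul_in_span ver_idem[OF v] liveD(2)[OF v]] sc by metis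
  \<comment> \<open>Once \<open>c \<odot> s'\<close> is the unit of the corner, \<open>gho f\<close>
    factors through \<open>gho f \<odot> ar e\<close>, which is 0 by CK1.\<close>
  then have "gho f = gho f \<odot> (ar e \<odot> (r \<odot> s'))"
    using ghost_tail[of f] f' by (simp add: c_s'_def assoc)
  also have "\<dots> = 0" using CK1[of f e] e' f' ne by (simp add: assoc[symmetric])
  finally show False using CK1[of f f] f' liveD by auto
qed

subsection \<open>Minimal hitting sets\<close>

text \<open>
  Every live path either ends or meets such a set. By minimality a vertex of \<open>T\<close> that is not a sink
  lies on a cycle with no other vertex in \<open>T\<close>.
\<close>

definition hitting :: "'v set \<Rightarrow> bool" where
  "hitting T \<longleftrightarrow> T \<subseteq> live \<and> {v \<in> live. out v = {}} \<subseteq> T \<and> acyclic (fwd (live - T))"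

definition T :: "'v set" where
  "T = (SOME T. hitting T \<and> (\<forall>u\<in>T. \<not> hitting (T - {u})))"

text \<open>The set of all live vertices is hitting, and a finite family of sets has a minimal
  member.\<close>

lemma T: "hitting T" "u \<in> T \<Longrightarrow> \<not> hitting (T - {u})"
proof -
  have "hitting live" by (auto simp: hitting_def fwd_def acyclic_def)
  moreover have "finite {T. hitting T}"
    by (rule finite_subset[of _ "Pow live"]) (auto simp: hitting_def finite_live)
  ultimately obtain T0 where T0: "hitting T0" "\<And>S. hitting S \<Longrightarrow> S \<subseteq> T0 \<Longrightarrow> T0 = S"
    using finite_has_minimal[of "{T. hitting T}"] by blast
  then have "hitting T0 \<and> (\<forall>u\<in>T0. \<not> hitting (T0 - {u}))" by blast
  then have *: "hitting T \<and> (\<forall>u\<in>T. \<not> hitting (T - {u}))" unfolding T_def by (rule someI)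
  show "hitting T" "u \<in> T \<Longrightarrow> \<not> hitting (T - {u})" using * by auto
qed

lemma T_live: "T \<subseteq> live" and sink_T: "v \<in> live \<Longrightarrow> out v = {} \<Longrightarrow> v \<in> T"
  using T(1) by (auto simp: hitting_def)

abbreviation "R \<equiv> fwd (live - T)"

text \<open>Induction over successors outside \<open>T\<close>; this is what makes the sets of
  stopped paths finite.\<close>

lemma wf_R: "wf (R\<inverse>)"
  using T(1) finite_acyclic_wf_converse[of R] finite_fwd[of "live - T"]
  by (auto simp: hitting_def)

lemma R_live: "(v, w) \<in> R\<^sup>* \<Longrightarrow> (v, w) \<in> (fwd live)\<^sup>*"
  using rtrancl_mono[OF fwd_mono[of "live - T" live]] by blast

text \<open>Removing \<open>u\<close> from \<open>T\<close> must create a cycle, which passes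
  through \<open>u\<close> because \<open>R\<close> is acyclic. Cutting it at \<open>u\<close> gives
  the chain, and \<open>cycle_no_exit\<close> makes the arc unique.\<close>

lemma T_on_cycle:
  assumes u: "u \<in> T" and nonsink: "out u \<noteq> {}"
  obtains e where "out u = {e}" "(head G e, u) \<in> R\<^sup>*"
proof -
  let ?R' = "fwd (live - (T - {u}))"
  have "\<not> acyclic ?R'"
    using T(2)[OF u] T_live sink_T nonsink u by (auto simp: hitting_def)
  then obtain z where z: "(z, z) \<in> ?R'\<^sup>+" by (auto simp: acyclic_def)
  have split: "(a, b) \<in> R \<or> (a = u \<and> (\<exists>e\<in>out u. b = head G e))" if "(a, b) \<in> ?R'" for a b
    using that by (auto simp: fwd_def)
  have zz: "(z, z) \<notin> R\<^sup>+" using T(1) by (auto simp: hitting_def acyclic_def)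
  \<comment> \<open>Keep the part of the chain after its last departure from
    \<open>u\<close>.\<close>
  have "(a, b) \<in> R\<^sup>+ \<or> (\<exists>e\<in>out u. (head G e, b) \<in> R\<^sup>*)" if "(a, b) \<in> ?R'\<^sup>+" for a b
    using that
  proof (induction rule: trancl_induct)
    case (base y)
    then show ?case using split by blast
  next
    case (step y z)
    then show ?case using split[OF step.hyps(2)]
      by (blast intro: trancl_into_trancl rtrancl_into_rtrancl)
  qed
  then obtain e where e: "e \<in> out u" "(head G e, z) \<in> R\<^sup>*" using z zz by blast
  \<comment> \<open>Keep the part before the first arrival at \<open>u\<close>; the two parts are
    joined at \<open>z\<close>.\<close>
  have "(a, b) \<in> R\<^sup>+ \<or> (a, u) \<in> R\<^sup>*" if "(a, b) \<in> ?R'\<^sup>+" for a b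
    using that
  proof (induction rule: converse_trancl_induct)
    case (base y)
    then show ?case using split by blast
  next
    case (step y z)
    then show ?case using split[OF step.hyps(1)]
      by (blast intro: trancl_into_trancl2 converse_rtrancl_into_rtrancl)
  qed
  then have "(head G e, u) \<in> R\<^sup>*" using z zz e by (meson rtrancl_trans)
  moreover have "out u = {e}"
    using cycle_no_exit[of u e] R_live[OF calculation] e u T_live by blast
  ultimately show ?thesis using that by blast
qed

subsection \<open>Paths that stop when they first meet the hitting set\<close>

text \<open>From a vertex of \<open>T\<close> only the empty path is allowed. The end is an argument
  because an empty list of arcs does not determine it.\<close>

inductive hits :: "'v \<Rightarrow> 'e list \<Rightarrow> 'v \<Rightarrow> bool" where
  Nil: "u \<in> T \<Longrightarrow> hits u [] u"
| Cons: "\<lbrakk>v \<in> live; v \<notin> T; e \<in> out v; hits (head G e) p u\<rbrakk> \<Longrightarrow> hits v (e # p) u"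

inductive_cases hits_NilE: "hits v [] u"
inductive_cases hits_ConsE: "hits v (e # p) u"

primrec path :: "'e list \<Rightarrow> 'v \<Rightarrow> 'a" where
  "path [] u = ver u"
| "path (e # p) u = ar e \<odot> path p u"

primrec gpath :: "'e list \<Rightarrow> 'v \<Rightarrow> 'a" where
  "gpath [] u = ver u"
| "gpath (e # p) u = gpath p u \<odot> gho e"

lemma hits_in: "hits v p u \<Longrightarrow> v \<in> live \<and> u \<in> T \<and> (v \<in> T \<longleftrightarrow> p = [])"
  by (induction rule: hits.induct) (use T_live in auto)

lemma hits_reach: "hits v p u \<Longrightarrow> (v, u) \<in> (fwd live)\<^sup>*"
proof (induction rule: hits.induct)
  case (Cons v e p u)
  then have "(v, head G e) \<in> fwd live" by (auto simp: fwd_def)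
  then show ?case using Cons by simp
qed simp

lemma hits_source: "hits v p u \<Longrightarrow> hits w p u \<Longrightarrow> v = w"
  using outD(2) by (cases p) (metis hits_NilE hits_ConsE)+

lemma path_units:
  assumes "hits v p u"
  shows "ver v \<odot> path p u = path p u" "path p u \<odot> ver u = path p u"
    "gpath p u \<odot> ver v = gpath p u" "ver u \<odot> gpath p u = gpath p u"
proof -
  have "ver v \<odot> path p u = path p u \<and> path p u \<odot> ver u = path p u \<and>
    gpath p u \<odot> ver v = gpath p u \<and> ver u \<odot> gpath p u = gpath p u"
    using assms
  proof (induction rule: hits.induct)
    case (Nil u)
    then show ?case using T_live ver_idem by auto
  next
    case (Cons v e p u)
    have e: "e \<in> arcs G" "tail G e = v" using outD[OF Cons.hyps(3)] by auto
    have "ver v \<odot> ar e \<odot> path p u = ar e \<odot> path p u"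
      using tail_arc[OF e(1)] e(2) by simp
    moreover have "gpath p u \<odot> (gho e \<odot> ver v) = gpath p u \<odot> gho e"
      using ghost_tail[OF e(1)] e(2) by simp
    ultimately show ?case using Cons.IH by (simp add: assoc) (simp flip: assoc)
  qed
  then show "ver v \<odot> path p u = path p u" "path p u \<odot> ver u = path p u"
    "gpath p u \<odot> ver v = gpath p u" "ver u \<odot> gpath p u = gpath p u" by auto
qed

lemma gho_path_Cons:
  assumes "e \<in> arcs G" "hits v (f # p) u"
  shows "gho e \<odot> path (f # p) u = (if e = f then path p u else 0)"
proof -
  have f: "f \<in> arcs G" "hits (head G f) p u" using assms(2) outD by (auto elim: hits_ConsE)
  have "gho e \<odot> path (f # p) u = (gho e \<odot> ar f) \<odot> path p u" by (simp add: assoc)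
  then show ?thesis using CK1[OF assms(1) f(1)] path_units(1)[OF f(2)] by auto
qed

text \<open>Both paths stop on first meeting \<open>T\<close>, so neither is a proper prefix of the
  other: if they differ, they diverge at some arc, where CK1 gives 0.\<close>

lemma gpath_path_same_source:
  assumes "hits v p u" "hits v q w"
  shows "gpath p u \<odot> path q w = (if p = q \<and> u = w then ver u else 0)"
  using assms
proof (induction arbitrary: q w rule: hits.induct)
  case (Nil u)
  then have "q = []" "w = u" using hits_in[OF Nil.prems] by (auto elim: hits_NilE)
  then show ?case using Nil T_live ver_idem by auto
next
  case (Cons v e p u)
  then obtain f q' where q: "q = f # q'" using hits_in[OF Cons.prems] by (cases q) auto
  have e: "e \<in> arcs G" using outD Cons.hyps by blast
  have q': "hits (head G f) q' w" using Cons.prems by (auto simp: q elim: hits_ConsE)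
  have "gpath (e # p) u \<odot> path q w = gpath p u \<odot> (gho e \<odot> path (f # q') w)"
    by (simp add: q assoc)
  also have "\<dots> = (if e = f then gpath p u \<odot> path q' w else 0)"
    using gho_path_Cons[OF e Cons.prems[unfolded q]] by simp
  finally show ?case using Cons.IH q' by (auto simp: q)
qed

lemma gpath_path:
  assumes "hits v p u" "hits v' q w"
  shows "gpath p u \<odot> path q w = (if p = q \<and> u = w then ver u else 0)"
proof (cases "v = v'")
  case True
  then show ?thesis using gpath_path_same_source assms by blast
next
  case False
  have "gpath p u \<odot> path q w = (gpath p u \<odot> ver v) \<odot> (ver v' \<odot> path q w)"
    using path_units assms by simp
  also have "\<dots> = gpath p u \<odot> ((ver v \<odot> ver v') \<odot> path q w)" by (simp add: assoc)
  also have "\<dots> = 0" using False assms hits_in liveD(1) by (simp add: ver_orth)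
  finally show ?thesis using False hits_source assms by auto
qed

text \<open>CK2 is applied at every vertex outside \<open>T\<close>: \<open>wf_R\<close> makes this
  terminate, and row-finiteness keeps the branching finite.\<close>

lemma paths_from:
  assumes "v \<in> live"
  shows "finite {(p, u). hits v p u} \<and>
    (\<Sum>(p, u)\<in>{(p, u). hits v p u}. path p u \<odot> gpath p u) = ver v"
  using wf_R assms
proof (induction v rule: wf_induct_rule)
  case (less v)
  let ?H = "\<lambda>v. {(p, u). hits v p u}"
  show ?case
  proof (cases "v \<in> T")
    case True
    then have "?H v = {([], v)}" using hits_in by (auto intro: hits.Nil elim: hits_NilE)
    then show ?thesis using ver_idem less.prems by simp
  next
    case False
    then have ne: "out v \<noteq> {}" using less.prems sink_T by blast
    let ?S = "SIGMA e:out v. ?H (head G e)" and ?c = "\<lambda>(e, p, u). (e # p, u)"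
    have H: "?H v = ?c ` ?S"
    proof (intro equalityI subsetI)
      fix x assume "x \<in> ?H v"
      then obtain p u where x: "x = (p, u)" "hits v p u" by blast
      then obtain e p' where p: "p = e # p'" using hits_in[OF x(2)] False by (cases p) auto
      then have "(e, p', u) \<in> ?S" using x by (auto elim: hits_ConsE)
      then show "x \<in> ?c ` ?S" using x p by (intro image_eqI[of _ _ "(e, p', u)"]) auto
    next
      fix x assume "x \<in> ?c ` ?S"
      then show "x \<in> ?H v" using False less.prems by (auto intro: hits.Cons)
    qed
    have inj: "inj_on ?c ?S" by (auto simp: inj_on_def)
    have IH: "finite (?H (head G e))"
      "(\<Sum>(p, u)\<in>?H (head G e). path p u \<odot> gpath p u) = ver (head G e)" if "e \<in> out v" for e
    proof -
      have "(head G e, v) \<in> R\<inverse>" using that False less.prems by (auto simp: fwd_def)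
      then show "finite (?H (head G e))"
        "(\<Sum>(p, u)\<in>?H (head G e). path p u \<odot> gpath p u) = ver (head G e)"
        using less.IH outD(3)[OF that] by blast+
    qed
    have fin: "finite ?S" using IH(1) finite_out less.prems by blast
    have "(\<Sum>(p, u)\<in>?H v. path p u \<odot> gpath p u) =
        (\<Sum>(e, p, u)\<in>?S. ar e \<odot> (path p u \<odot> gpath p u) \<odot> gho e)"
      unfolding H by (subst sum.reindex[OF inj]) (auto intro!: sum.cong simp: assoc)
    also have "\<dots> = (\<Sum>e\<in>out v. \<Sum>(p, u)\<in>?H (head G e). ar e \<odot> (path p u \<odot> gpath p u) \<odot> gho e)"
      using finite_out less.prems IH(1) by (subst sum.Sigma) auto
    also have "\<dots> = (\<Sum>e\<in>out v. ar e \<odot> ver (head G e) \<odot> gho e)"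
      using IH(2) by (intro sum.cong refl) (simp flip: sum_mul mul_sum add: case_prod_beta)
    also have "\<dots> = (\<Sum>e\<in>out v. ar e \<odot> gho e)"
      using arc_head outD(1) by (intro sum.cong refl) simp
    also have "\<dots> = ver v" using ver_expand ne less.prems by simp
    finally show ?thesis using fin by (simp add: H)
  qed
qed

text \<open>The chain of \<open>T_on_cycle\<close> gives \<open>p\<close>. It is the only stopped
  path from there because its vertices lie on a cycle, where \<open>cycle_no_exit\<close> leaves no
  choice of arc.\<close>

lemma cycle_path:
  assumes u: "u \<in> T" and nonsink: "out u \<noteq> {}"
  obtains e p where "out u = {e}" "hits (head G e) p u"
    "\<And>q w. hits (head G e) q w \<Longrightarrow> q = p \<and> w = u"
proof -
  obtain e where e: "out u = {e}" "(head G e, u) \<in> R\<^sup>*" using T_on_cycle[OF assms] .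
  have "\<exists>p. hits z p u" if "(z, u) \<in> R\<^sup>*" for z
    using that
  proof (induction rule: converse_rtrancl_induct)
    case base
    then show ?case using u hits.Nil by blast
  next
    case (step y z)
    then show ?case by (auto simp: fwd_def intro: hits.Cons)
  qed
  then obtain p where p: "hits (head G e) p u" using e by blast
  have u_e: "(u, head G e) \<in> fwd live" using e(1) u T_live by (auto simp: fwd_def)
  \<comment> \<open>The chain from \<open>head G e\<close> to \<open>z\<close> is carried along:
    with \<open>hits z p u\<close> and the arc back to \<open>head G e\<close> it closes the cycle
    that \<open>cycle_no_exit\<close> needs.\<close>
  have "q = p \<and> w = u" if "hits z q w" "(head G e, z) \<in> (fwd live)\<^sup>*" "hits z p u" for z q w p
    using that
  proof (induction arbitrary: p rule: hits.induct)
    case (Nil z)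
    then show ?case using hits_in[OF Nil.prems(2)] by (auto elim: hits_NilE)
  next
    case (Cons z f q w)
    then obtain f' p' where p: "p = f' # p'" using hits_in[OF Cons.prems(2)] by (cases p) auto
    have f': "f' \<in> out z" "hits (head G f') p' u"
      using Cons.prems(2) by (auto simp: p elim: hits_ConsE)
    have "(head G f', z) \<in> (fwd live)\<^sup>*"
      using hits_reach[OF f'(2)] u_e Cons.prems(1) by (meson converse_rtrancl_into_rtrancl rtrancl_trans)
    then have "f = f'" using cycle_no_exit Cons.hyps f' by blast
    moreover have "(head G e, head G f) \<in> (fwd live)\<^sup>*"
      using Cons.prems(1) Cons.hyps by (auto simp: fwd_def intro: rtrancl_into_rtrancl)
    ultimately show ?case using Cons.IH[of p'] f' p by simp
  qed
  then show ?thesis using that e p by blast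
qed

subsection \<open>Corners\<close>

text \<open>All facts on the corner of \<open>u\<close> are bundled so that they survive the choice
  of \<open>c\<close> and \<open>P\<close>. For a sink the last conjunct is vacuous; otherwise it
  rewrites the ghost of the arc leaving \<open>u\<close> as a path times a polynomial in the
  cycle.\<close>

definition is_cycle :: "'v \<Rightarrow> 'a \<Rightarrow> 'f poly \<Rightarrow> bool" where
  "is_cycle u c P \<longleftrightarrow> poly P 0 = 1 \<and> degree P > 0 \<and>
    (\<forall>q. ev (ver u) c q = 0 \<longleftrightarrow> P dvd q) \<and> ver u \<odot> c = c \<and> c \<odot> ver u = c \<and>
    (\<forall>e\<in>out u. \<exists>p Q. hits (head G e) p u \<and> (\<forall>q w. hits (head G e) q w \<longrightarrow> q = p \<and> w = u) \<and>
       ar e \<odot> path p u = c \<and> gho e = path p u \<odot> ev (ver u) c Q)"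

lemma ex_is_cycle:
  assumes u: "u \<in> T"
  shows "\<exists>c P. is_cycle u c P"
proof -
  have ul: "u \<in> live" using u T_live by blast
  note corner = left_invertible_corner[OF finite_B mul_in_span ver_idem[OF ul] liveD(2)[OF ul]]
  show ?thesis
  proof (cases "out u = {}")
    case True
    \<comment> \<open>At a sink \<open>c\<close> and its inverse are both \<open>ver u\<close>.
      Evaluation is then \<open>q \<mapsto> q(1)\<close> times \<open>ver u\<close>, so
      \<open>P\<close> is \<open>1 - x\<close>.\<close>
    obtain P where "poly P 0 = 1" "degree P > 0" "\<And>q. ev (ver u) (ver u) q = 0 \<longleftrightarrow> P dvd q"
      using corner[of "ver u" "ver u"] ver_idem[OF ul] by metis
    then show ?thesis using True ver_idem[OF ul] by (auto simp: is_cycle_def)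
  next
    case False
    then obtain e p where e: "out u = {e}" and p: "hits (head G e) p u"
      and unique: "\<And>q w. hits (head G e) q w \<Longrightarrow> q = p \<and> w = u" using cycle_path[OF u] by metis
    have e': "e \<in> arcs G" "tail G e = u" "head G e \<in> live" using outD[of e u] e by auto
    define c s where "c = ar e \<odot> path p u" "s = gpath p u \<odot> gho e"
    have "s \<odot> c = gpath p u \<odot> ((gho e \<odot> ar e) \<odot> path p u)" by (simp add: c_s_def assoc)
    also have "\<dots> = ver u"
      using CK1[OF e'(1,1)] path_units[OF p] gpath_path[OF p p] by simp
    finally have sc: "s \<odot> c = ver u" .
    have c: "ver u \<odot> c = c" using tail_arc[OF e'(1)] e' by (simp add: c_s_def flip: assoc)
    have c': "c \<odot> ver u = c" using path_units[OF p] by (simp add: c_s_def assoc)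
    have s: "s \<odot> ver u = s" using ghost_tail[OF e'(1)] e' by (simp add: c_s_def assoc)
    obtain P Q where P: "poly P 0 = 1" "degree P > 0" "\<And>q. ev (ver u) c q = 0 \<longleftrightarrow> P dvd q"
      and Q: "s = ev (ver u) c Q"
      using corner[OF c c' s sc] by metis
    \<comment> \<open>With one stopped path from \<open>head G e\<close>, the expansion of that
      vertex has the single term \<open>path p u \<odot> gpath p u\<close>; hence
      \<open>gho e\<close> is \<open>path p u \<odot> s\<close>.\<close>
    have "{(q, w). hits (head G e) q w} = {(p, u)}" using p by (blast dest: unique)
    then have "path p u \<odot> gpath p u = ver (head G e)" using paths_from[OF e'(3)] by simp
    then have "gho e = path p u \<odot> s" using head_ghost[OF e'(1)] by (simp add: c_s_def flip: assoc)
    then have "\<exists>p Q. hits (head G e) p u \<and> (\<forall>q w. hits (head G e) q w \<longrightarrow> q = p \<and> w = u) \<and>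
       ar e \<odot> path p u = c \<and> gho e = path p u \<odot> ev (ver u) c Q"
      using Q p unique c_s_def(1) by blast
    then have "is_cycle u c P" using P c c' unfolding is_cycle_def e by blast
    then show ?thesis by blast
  qed
qed

definition cyc :: "'v \<Rightarrow> 'a" where "cyc u = (SOME c. \<exists>P. is_cycle u c P)"
definition mpoly :: "'v \<Rightarrow> 'f poly" where "mpoly u = (SOME P. is_cycle u (cyc u) P)"

lemma is_cycle: "u \<in> T \<Longrightarrow> is_cycle u (cyc u) (mpoly u)"
  unfolding mpoly_def cyc_def using ex_is_cycle[of u] by (metis (mono_tags, lifting) someI_ex)

abbreviation evc :: "'v \<Rightarrow> 'f poly \<Rightarrow> 'a" where "evc u \<equiv> ev (ver u) (cyc u)"

lemma cyc_units: "u \<in> T \<Longrightarrow> ver u \<odot> cyc u = cyc u" "u \<in> T \<Longrightarrow> cyc u \<odot> ver u = cyc u"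
  using is_cycle by (auto simp: is_cycle_def)

lemma mpoly: "u \<in> T \<Longrightarrow> poly (mpoly u) 0 = 1" "u \<in> T \<Longrightarrow> degree (mpoly u) > 0"
  "u \<in> T \<Longrightarrow> evc u q = 0 \<longleftrightarrow> mpoly u dvd q"
  using is_cycle by (auto simp: is_cycle_def)

lemma evc_mult: "u \<in> T \<Longrightarrow> evc u (p * q) = evc u p \<odot> evc u q"
  using ev_mult cyc_units ver_idem T_live by blast

lemma evc_units: "u \<in> T \<Longrightarrow> ver u \<odot> evc u p = evc u p" "u \<in> T \<Longrightarrow> evc u p \<odot> ver u = evc u p"
  using ev_unit_left ev_unit_right cyc_units ver_idem T_live by blast+

section \<open>Normal forms and the decomposition of the unit\<close>

definition J :: "('e list \<times> 'v) set" where
  "J = {(p, u). \<exists>v. hits v p u}"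

lemma J_T: "(p, u) \<in> J \<Longrightarrow> u \<in> T"
  using hits_in by (auto simp: J_def)

lemma finite_J: "finite J"
proof -
  have "J \<subseteq> (\<Union>v\<in>live. {(p, u). hits v p u})" using hits_in by (auto simp: J_def)
  then show ?thesis using paths_from finite_live by (meson finite_UN finite_subset)
qed

lemma J_gpath_path: "(p, u) \<in> J \<Longrightarrow> (q, w) \<in> J \<Longrightarrow>
    gpath p u \<odot> path q w = (if p = q \<and> u = w then ver u else 0)"
  using gpath_path by (auto simp: J_def)

lemma J_path_units:
  assumes "(p, u) \<in> J"
  shows "path p u \<odot> ver u = path p u" "ver u \<odot> gpath p u = gpath p u"
  using assms path_units by (auto simp: J_def)

text \<open>Normal forms, whose span is stable under left multiplication by generators. Polynomials
  suffice in the middle because the inverse of the cycle is one too.\<close>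

definition D :: "'a set" where
  "D = {path p u \<odot> evc u b \<odot> gpath q u | p q u b. (p, u) \<in> J \<and> (q, u) \<in> J}"

text \<open>A generator lengthens the path, shortens it, fixes it or kills it, except at
  \<open>T\<close>: there an arc may close the cycle, and a ghost arc runs backwards along
  it.\<close>

lemma gen_path:
  assumes g: "g \<in> lpa_gens G" and pu: "(p, u) \<in> J"
  shows "X g \<odot> path p u = 0 \<or> (\<exists>q b. (q, u) \<in> J \<and> X g \<odot> path p u = path q u \<odot> evc u b)"
proof -
  obtain v where v: "hits v p u" using pu by (auto simp: J_def)
  have vl: "v \<in> live" and u: "u \<in> T" using hits_in[OF v] by auto
  note unit = path_units[OF v]
  have unit': "path q u = path q u \<odot> evc u 1" if "(q, u) \<in> J" for q
    using J_path_units[OF that] by simp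
  consider w where "g = Vtx w" "w \<in> verts G" | e where "g = Arc e" "e \<in> arcs G"
    | e where "g = Ghost e" "e \<in> arcs G" using g by (auto simp: lpa_gens_def)
  then show ?thesis
  proof cases
    case (1 w)
    have "X g \<odot> path p u = (ver w \<odot> ver v) \<odot> path p u" using unit by (simp add: 1 assoc)
    then have "X g \<odot> path p u = (if w = v then path p u else 0)"
      using vertex_mul[of w v] 1 liveD(1)[OF vl] unit by simp
    then show ?thesis using unit'[OF pu] pu by metis
  next
    case (2 e)
    show ?thesis
    proof (cases "head G e = v")
      case False
      have "X g \<odot> path p u = (ar e \<odot> ver (head G e)) \<odot> (ver v \<odot> path p u)"
        using unit arc_head 2 by simp
      also have "\<dots> = ar e \<odot> ((ver (head G e) \<odot> ver v) \<odot> path p u)" by (simp add: assoc)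
      also have "\<dots> = 0" using False liveD(1)[OF vl] 2 by (simp add: ver_orth)
      finally show ?thesis by simp
    next
      case True
      have e: "tail G e \<in> live" "e \<in> out (tail G e)" using tail_live 2 True vl by auto
      show ?thesis
      proof (cases "tail G e \<in> T")
        case False
        then have "(e # p, u) \<in> J" using e v True by (auto simp: J_def intro: hits.Cons)
        then show ?thesis using unit'[of "e # p"] 2 by (metis path.simps(2))
      next
        case tT: True
        then obtain p' where p': "\<And>q w. hits (head G e) q w \<Longrightarrow> q = p' \<and> w = tail G e"
          "ar e \<odot> path p' (tail G e) = cyc (tail G e)"
          using is_cycle[OF tT] e(2) unfolding is_cycle_def by blast
        \<comment> \<open>Uniqueness in \<open>is_cycle\<close> forces \<open>p\<close> to be the
          rest of the cycle and \<open>u\<close> to be the tail of \<open>e\<close>.\<close>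
        have "X g \<odot> path p u = cyc u" using p' v True 2 by blast
        also have "\<dots> = path [] u \<odot> evc u [:0, 1:]" using u cyc_units by simp
        finally show ?thesis using hits.Nil[OF u] unfolding J_def by blast
      qed
    qed
  next
    case (3 e)
    show ?thesis
    proof (cases "tail G e = v")
      case False
      have "X g \<odot> path p u = (gho e \<odot> ver (tail G e)) \<odot> (ver v \<odot> path p u)"
        using unit ghost_tail 3 by simp
      also have "\<dots> = gho e \<odot> ((ver (tail G e) \<odot> ver v) \<odot> path p u)" by (simp add: assoc)
      also have "\<dots> = 0" using False liveD(1)[OF vl] 3 by (simp add: ver_orth)
      finally show ?thesis by simp
    next
      case True
      show ?thesis
      proof (cases p)
        case Nil
        then have vu: "v = u" using v by (auto elim: hits_NilE)
        show ?thesis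
        proof (cases "head G e \<in> live")
          case False
          then show ?thesis using dead_arc 3 by simp
        next
          case hl: True
          have "e \<in> out u" using tail_live(2)[OF 3(2) hl] True vu by simp
          \<comment> \<open>Here the inverse of the cycle is used: \<open>Q\<close> expresses it as
            a polynomial in \<open>cyc u\<close>.\<close>
          then obtain p' Q where p': "hits (head G e) p' u" "gho e = path p' u \<odot> evc u Q"
            using is_cycle[OF u] unfolding is_cycle_def by blast
          have "X g \<odot> path p u = path p' u \<odot> evc u Q"
            using ghost_tail[OF 3(2)] True vu p' by (simp add: 3 Nil)
          moreover have "(p', u) \<in> J" using p' by (auto simp: J_def)
          ultimately show ?thesis by blast
        qed
      next
        case (Cons f q)
        have "(q, u) \<in> J" using v Cons by (auto simp: J_def elim: hits_ConsE)
        then show ?thesis using gho_path_Cons[OF 3(2)] v Cons 3 unit'[of q] by metis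
      qed
    qed
  qed
qed

lemma ver_span: "v \<in> verts G \<Longrightarrow> ver v \<in> span D"
proof (cases "v \<in> live")
  case True
  have "path p u \<odot> gpath p u \<in> D" if "hits v p u" for p u
  proof -
    have "path p u \<odot> gpath p u = path p u \<odot> evc u 1 \<odot> gpath p u"
      using path_units[OF that] by (simp add: assoc)
    then show ?thesis using that unfolding D_def J_def by blast
  qed
  then have "(\<Sum>(p, u)\<in>{(p, u). hits v p u}. path p u \<odot> gpath p u) \<in> span D"
    by (intro span_sum) (auto intro: span_base)
  then show ?thesis using paths_from[OF True] by simp
qed (simp add: live_def span_zero)

text \<open>By \<open>C_least\<close> only left multiplication has to be examined; it changes the
  path and the polynomial and leaves the ghost path alone.\<close>

lemma C_D: "C \<subseteq> span D"
proof (rule C_least)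
  have D: "X g \<odot> d \<in> span D" if "g \<in> lpa_gens G" "d \<in> D" for g d
  proof -
    obtain p q u b where d: "d = path p u \<odot> evc u b \<odot> gpath q u" "(p, u) \<in> J" "(q, u) \<in> J"
      using \<open>d \<in> D\<close> by (auto simp: D_def)
    have eq: "X g \<odot> d = (X g \<odot> path p u) \<odot> (evc u b \<odot> gpath q u)" by (simp add: d assoc)
    from gen_path[OF that(1) d(2)] show ?thesis
    proof (elim disjE exE conjE)
      fix q' b' assume q': "(q', u) \<in> J" "X g \<odot> path p u = path q' u \<odot> evc u b'"
      then have "X g \<odot> d = path q' u \<odot> evc u (b' * b) \<odot> gpath q u"
        using J_T[OF q'(1)] by (simp add: eq evc_mult assoc)
      then show ?thesis using q' d by (auto simp: D_def intro!: span_base)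
    qed (simp add: eq span_zero)
  qed
  show mul: "X g \<odot> x \<in> span D" if "g \<in> lpa_gens G" "x \<in> span D" for g x
    using span_mul_left D that by blast
  \<comment> \<open>Every generator is itself times its target vertex, and vertices lie in the span
    by \<open>ver_span\<close>.\<close>
  show "X g \<in> span D" if g: "g \<in> lpa_gens G" for g
  proof -
    obtain v where "v \<in> verts G" "X g \<odot> ver v = X g"
      using g vertex_mul arc_head ghost_tail head_in_verts tail_in_verts
      unfolding lpa_gens_def by (elim UnE imageE) metis+
    then show ?thesis using mul[OF g ver_span] by metis
  qed
qed (rule subspace_span)

text \<open>On a normal form that starts with \<open>path q w\<close> only the summand of
  \<open>(q, w)\<close> survives, and it restores the path.\<close>

lemma unit_left:
  assumes "x \<in> C"
  shows "(\<Sum>(p, u)\<in>J. path p u \<odot> (gpath p u \<odot> x)) = x"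
proof -
  have "x \<in> span D" using C_D assms by blast
  then show ?thesis
  proof (induction rule: span_induct_alt)
    case base
    then show ?case by (simp add: case_prod_beta)
  next
    case (step c x y)
    then obtain q w z where x: "x = path q w \<odot> z" "(q, w) \<in> J" by (auto simp: D_def assoc)
    have "(\<Sum>(p, u)\<in>J. path p u \<odot> (gpath p u \<odot> x)) = (\<Sum>i\<in>J. if i = (q, w) then x else 0)"
    proof (rule sum.cong[OF refl], clarify)
      fix p u assume pu: "(p, u) \<in> J"
      have "path p u \<odot> (gpath p u \<odot> x) = path p u \<odot> ((gpath p u \<odot> path q w) \<odot> z)"
        by (simp add: x assoc)
      then show "path p u \<odot> (gpath p u \<odot> x) = (if (p, u) = (q, w) then x else 0)"
        using J_gpath_path[OF pu x(2)] J_path_units[OF pu] by (auto simp: x(1) simp flip: assoc)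
    qed
    then have "(\<Sum>(p, u)\<in>J. path p u \<odot> (gpath p u \<odot> x)) = x" using finite_J x by simp
    then show ?case
      using step.IH by (simp add: case_prod_beta mul_add mul_scale sum.distrib flip: scale_sum_right)
  qed
qed

lemma unit_right:
  assumes "x \<in> C"
  shows "(\<Sum>(p, u)\<in>J. (x \<odot> path p u) \<odot> gpath p u) = x"
proof -
  have "x \<in> span D" using C_D assms by blast
  then show ?thesis
  proof (induction rule: span_induct_alt)
    case base
    then show ?case by (simp add: case_prod_beta)
  next
    case (step c x y)
    then obtain q w z where x: "x = z \<odot> gpath q w" "(q, w) \<in> J" by (auto simp: D_def)
    have "(\<Sum>(p, u)\<in>J. (x \<odot> path p u) \<odot> gpath p u) = (\<Sum>i\<in>J. if i = (q, w) then x else 0)"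
    proof (rule sum.cong[OF refl], clarify)
      fix p u assume pu: "(p, u) \<in> J"
      have "(x \<odot> path p u) \<odot> gpath p u = z \<odot> ((gpath q w \<odot> path p u) \<odot> gpath p u)"
        by (simp add: x assoc)
      then show "(x \<odot> path p u) \<odot> gpath p u = (if (p, u) = (q, w) then x else 0)"
        using J_gpath_path[OF x(2) pu] J_path_units[OF pu] by (auto simp: x(1))
    qed
    then have "(\<Sum>(p, u)\<in>J. (x \<odot> path p u) \<odot> gpath p u) = x" using finite_J x by simp
    then show ?case
      using step.IH by (simp add: case_prod_beta add_mul scale_mul sum.distrib flip: scale_sum_right)
  qed
qed

text \<open>On a normal form the outer products are matrix unit relations, so only the middle
  polynomial can remain. The two cases supply the entries of a block and the vanishing between
  blocks.\<close>

lemma corner: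
  assumes x: "x \<in> C" and pu: "(p, u) \<in> J" and qw: "(q, w) \<in> J"
  shows "\<exists>b. gpath p u \<odot> x \<odot> path q w = (if u = w then evc u b else 0)"
proof -
  have "x \<in> span D" using C_D x by blast
  then show ?thesis
  proof (induction rule: span_induct_alt)
    case base
    then show ?case by (auto intro: exI[of _ 0])
  next
    case (step c x y)
    then obtain p' q' t b where x: "x = path p' t \<odot> evc t b \<odot> gpath q' t" "(p', t) \<in> J" "(q', t) \<in> J"
      by (auto simp: D_def)
    have "gpath p u \<odot> x \<odot> path q w = (gpath p u \<odot> path p' t) \<odot> evc t b \<odot> (gpath q' t \<odot> path q w)"
      by (simp add: x assoc)
    also have "\<dots> = (if u = w then evc u (if p = p' \<and> q = q' \<and> u = t then b else 0) else 0)"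
      using J_gpath_path[OF pu x(2)] J_gpath_path[OF x(3) qw] J_T[OF pu] by (auto simp: evc_units)
    finally obtain b1 where b1: "gpath p u \<odot> x \<odot> path q w = (if u = w then evc u b1 else 0)" by blast
    obtain b2 where b2: "gpath p u \<odot> y \<odot> path q w = (if u = w then evc u b2 else 0)"
      using step.IH by blast
    have "gpath p u \<odot> (scale c x + y) \<odot> path q w = (if u = w then evc u (smult c b1 + b2) else 0)"
      using b1 b2 by (simp add: mul_add add_mul mul_scale scale_mul ev_add ev_smult)
    then show ?case by blast
  qed
qed

subsection \<open>The isomorphism\<close>

text \<open>First isomorphism theorem for evaluation at the cycle, whose kernel is the ideal of
  \<open>mpoly u\<close>.\<close>

lemma corner_iso:
  assumes u: "u \<in> T"
  shows "\<exists>\<theta>. alg_iso \<theta> (sub_alg (range (evc u))) (poly_quotient_alg (mpoly u)) \<and>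
    \<theta> 0 = alg_zero (poly_quotient_alg (mpoly u))"
proof -
  have coset: "alg_coset poly_alg (alg_ideal_gen poly_alg {mpoly u}) a =
      {b \<in> alg_carrier poly_alg. evc u b = evc u a}" for a
  proof -
    have "b \<in> alg_coset poly_alg (alg_ideal_gen poly_alg {mpoly u}) a \<longleftrightarrow> mpoly u dvd b - a" for b
      unfolding alg_coset_def alg_ideal_gen_poly
      by (auto simp: poly_alg_def intro!: exI[of _ "b - a"])
    also have "mpoly u dvd b - a \<longleftrightarrow> evc u b = evc u a" for b
      by (simp add: ev_diff flip: mpoly(3)[OF u])
    finally show ?thesis by (auto simp: poly_alg_def)
  qed
  have closed: "alg_closed (poly_alg :: ('f, 'f poly) alg)" by (simp add: alg_closed_def poly_alg_def)
  show ?thesis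
    using quotient_fibres[of poly_alg "alg_ideal_gen poly_alg {mpoly u}" "evc u"
        "sub_alg (range (evc u))", OF closed coset]
    by (auto simp: poly_alg_def poly_quotient_alg_def ev_add ev_smult evc_mult[OF u])
qed

theorem sub_alg_C_iso:
  "\<exists>m n P \<Phi>. (\<forall>k<m. n k > 0 \<and> degree (P k) > 0 \<and> poly (P k) 0 = 1) \<and>
     alg_iso \<Phi> (sub_alg C)
       (alg_direct_sum m (\<lambda>k. matrix_alg (n k) (poly_quotient_alg (P k :: 'f poly))))"
proof -
  have "finite T" using T_live finite_live finite_subset by blast
  define m where "m = card T"
  \<comment> \<open>Blocks are indexed by the vertices of \<open>T\<close>, and the rows of block
    \<open>k\<close> by the stopped paths ending at \<open>t k\<close>.\<close>
  obtain t where t: "bij_betw t {..<m} T"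
    using ex_bij_betw_nat_finite[OF \<open>finite T\<close>] by (auto simp: m_def atLeast0LessThan)
  have tT: "t k \<in> T" if "k < m" for k using that t by (auto dest: bij_betw_apply)
  define Ju where "Ju u = {p. (p, u) \<in> J}" for u
  have finite_Ju: "finite (Ju u)" for u
    using finite_J by (rule finite_surj[of _ _ fst]) (force simp: Ju_def)
  define n where "n k = card (Ju (t k))" for k
  have "\<exists>f. bij_betw f {..<n k} (Ju (t k))" for k
    using ex_bij_betw_nat_finite[OF finite_Ju] by (auto simp: n_def atLeast0LessThan)
  then obtain f where f: "\<And>k. bij_betw (f k) {..<n k} (Ju (t k))" by metis
  have fJ: "(f k i, t k) \<in> J" if "i < n k" for k i
    using that bij_betw_apply[OF f] by (auto simp: Ju_def)
  have n_pos: "n k > 0" if "k < m" for k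
  proof -
    \<comment> \<open>The empty path at \<open>t k\<close> guarantees that the block has positive
      size.\<close>
    have "[] \<in> Ju (t k)" using hits.Nil[OF tT[OF that]] by (auto simp: Ju_def J_def)
    then show ?thesis using finite_Ju by (auto simp: n_def card_gt_0_iff)
  qed
  have same: "f k i = f l j \<and> t k = t l \<longleftrightarrow> k = l \<and> i = j"
    if "k < m" "i < n k" "l < m" "j < n l" for k i l j
    using that inj_on_eq_iff[OF bij_betw_imp_inj_on[OF t], of k l]
      inj_on_eq_iff[OF bij_betw_imp_inj_on[OF f[of k]], of i j] by auto
  have reindex: "(\<Sum>(p, u)\<in>J. g p u) = (\<Sum>k<m. \<Sum>i<n k. g (f k i) (t k))" for g :: "'e list \<Rightarrow> 'v \<Rightarrow> 'a"
  proof -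
    let ?S = "SIGMA k:{..<m}. {..<n k}" and ?h = "\<lambda>(k, i). (f k i, t k)"
    have "bij_betw ?h ?S J"
      unfolding bij_betw_def
    proof
      show "inj_on ?h ?S" using same by (auto simp: inj_on_def)
      show "?h ` ?S = J"
      proof
        show "?h ` ?S \<subseteq> J" using fJ by auto
        show "J \<subseteq> ?h ` ?S"
        proof
          fix x assume "x \<in> J"
          then obtain p u where x: "x = (p, u)" "(p, u) \<in> J" by (cases x) auto
          then obtain k where k: "k < m" "t k = u"
            using J_T t by (metis bij_betw_def imageE lessThan_iff)
          then have "p \<in> f k ` {..<n k}" using f[of k] x by (simp add: Ju_def bij_betw_def)
          then show "x \<in> ?h ` ?S" using k x by force
        qed
      qed
    qed
    then have "(\<Sum>(p, u)\<in>J. g p u) = (\<Sum>x\<in>?S. case ?h x of (p, u) \<Rightarrow> g p u)"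
      by (rule sum.reindex_bij_betw[symmetric])
    also have "\<dots> = (\<Sum>k<m. \<Sum>i<n k. g (f k i) (t k))"
      by (subst sum.Sigma) (auto simp: case_prod_beta)
    finally show ?thesis .
  qed
  have "\<exists>\<theta>. k < m \<longrightarrow> alg_iso \<theta> (sub_alg (range (evc (t k)))) (poly_quotient_alg (mpoly (t k))) \<and>
      \<theta> 0 = alg_zero (poly_quotient_alg (mpoly (t k)))" for k
    using corner_iso[OF tT] by blast
  then obtain \<theta> where \<theta>: "\<And>k. k < m \<Longrightarrow>
      alg_iso (\<theta> k) (sub_alg (range (evc (t k)))) (poly_quotient_alg (mpoly (t k)))"
      "\<And>k. k < m \<Longrightarrow> \<theta> k 0 = alg_zero (poly_quotient_alg (mpoly (t k)))" by metis
  have "\<exists>\<Phi>. alg_iso \<Phi> (sub_alg C)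
      (alg_direct_sum m (\<lambda>k. matrix_alg (n k) (poly_quotient_alg (mpoly (t k)))))"
  proof (rule matrix_units_iso[where r = "\<lambda>k i. path (f k i) (t k)" and
        s = "\<lambda>k i. gpath (f k i) (t k)" and w = "\<lambda>k. ver (t k)" and K = "\<lambda>k. range (evc (t k))"
        and \<theta> = \<theta>])
    show "gpath (f k i) (t k) \<odot> path (f l j) (t l) = (if k = l \<and> i = j then ver (t k) else 0)"
      if "k < m" "i < n k" "l < m" "j < n l" for k i l j
      using J_gpath_path[OF fJ fJ] same that by simp
    show "(\<Sum>k<m. \<Sum>i<n k. path (f k i) (t k) \<odot> (gpath (f k i) (t k) \<odot> x)) = x" if "x \<in> C" for x
      using unit_left[OF that] by (simp add: reindex)
    show "(\<Sum>k<m. \<Sum>i<n k. (x \<odot> path (f k i) (t k)) \<odot> gpath (f k i) (t k)) = x" if "x \<in> C" for x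
      using unit_right[OF that] by (simp add: reindex)
    show "gpath (f k i) (t k) \<odot> x \<odot> path (f k j) (t k) \<in> range (evc (t k))"
      if "k < m" "i < n k" "j < n k" "x \<in> C" for k i j x
      using corner[OF that(4) fJ[OF that(2)] fJ[OF that(3)]] by auto
    show "gpath (f k i) (t k) \<odot> x \<odot> path (f l j) (t l) = 0"
      if "k < m" "i < n k" "l < m" "j < n l" "k \<noteq> l" "x \<in> C" for k i l j x
    proof -
      have "t k \<noteq> t l" using that t by (auto simp: bij_betw_def inj_on_def)
      then show ?thesis using corner[OF that(6) fJ[OF that(2)] fJ[OF that(4)]] by auto
    qed
    show "subspace (range (evc (t k)))" for k
      by (rule subspaceI) (auto simp flip: ev_add ev_smult intro: range_eqI[of _ _ 0])
    show "ver (t k) \<odot> y = y \<and> y \<odot> ver (t k) = y" if "k < m" "y \<in> range (evc (t k))" for k y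
      using that evc_units[OF tT] by auto
    show "y \<odot> z \<in> range (evc (t k))"
      if "k < m" "y \<in> range (evc (t k))" "z \<in> range (evc (t k))" for k y z
      using that by (auto simp flip: evc_mult[OF tT[OF that(1)]])
  qed (use subspace_C mul_in_C \<theta> in auto)
  moreover have "\<forall>k<m. n k > 0 \<and> degree (mpoly (t k)) > 0 \<and> poly (mpoly (t k)) 0 = 1"
    using n_pos mpoly tT by blast
  ultimately show ?thesis by (intro exI[of _ m] exI[of _ n] exI[of _ "\<lambda>k. mpoly (t k)"]) blast
qed

end

section \<open>Quotients of free algebras\<close>

text \<open>Projection along \<open>K\<close> onto a complement in \<open>S\<close>: a basis of
  \<open>K\<close> is extended to one of \<open>S\<close>, the old vectors are sent to 0 and the new
  ones fixed.\<close>

lemma (in vector_space) exists_reduction: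
  assumes K: "subspace K" and S: "subspace S" and KS: "K \<subseteq> S"
  shows "\<exists>\<rho>. Vector_Spaces.linear scale scale \<rho> \<and> range \<rho> \<subseteq> S \<and> (\<forall>x\<in>S. x - \<rho> x \<in> K) \<and> (\<forall>x\<in>K. \<rho> x = 0)"
proof -
  interpret P: vector_space_pair scale scale by standard
  obtain B0 where B0: "B0 \<subseteq> K" "independent B0" "K \<subseteq> span B0"
    by (rule maximal_independent_subset[of K])
  obtain B1 where B1: "B0 \<subseteq> B1" "B1 \<subseteq> S" "independent B1" "S \<subseteq> span B1"
    by (rule maximal_independent_subset_extend[OF subset_trans[OF B0(1) KS] B0(2)])
  define g where "g b = (if b \<in> B0 then 0 else b)" for b
  define \<rho> where "\<rho> = P.construct B1 g"
  interpret \<rho>: Vector_Spaces.linear scale scale \<rho> unfolding \<rho>_def by (rule P.linear_construct[OF B1(3)])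
  have \<rho>B: "\<rho> b = g b" if "b \<in> B1" for b
    unfolding \<rho>_def using that by (rule P.construct_basis[OF B1(3)])
  have "span (g ` B1) \<subseteq> S"
    using B1(2) S by (intro span_minimal) (auto simp: g_def subspace_0)
  then have range: "range \<rho> \<subseteq> S" using P.construct_in_span[OF B1(3), of g] by (auto simp: \<rho>_def)
  have "x - \<rho> x \<in> K" if "x \<in> span B1" for x
    using that
  proof (induction rule: span_induct_alt)
    case base
    then show ?case using K by (simp add: subspace_0)
  next
    case (step c x y)
    have "x - \<rho> x \<in> K" using step.hyps \<rho>B B0 K by (auto simp: g_def subspace_0)
    then have "scale c (x - \<rho> x) + (y - \<rho> y) \<in> K"
      using step.IH K by (intro subspace_add subspace_scale)
    then show ?case by (simp add: \<rho>.add \<rho>.scale scale_right_diff_distrib algebra_simps)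
  qed
  moreover have "\<rho> x = 0" if "x \<in> span B0" for x
    using that
  proof (induction rule: span_induct_alt)
    case (step c x y)
    then show ?case using \<rho>B B1 by (auto simp: \<rho>.add \<rho>.scale g_def)
  qed simp
  ultimately have "\<forall>x\<in>S. x - \<rho> x \<in> K" "\<forall>x\<in>K. \<rho> x = 0" using B0(3) B1(4) by auto
  then show ?thesis using \<rho>.linear_axioms range by (intro exI[of _ \<rho>] conjI)
qed

section \<open>The free algebra as a vector space\<close>

abbreviation fscale :: "'f::field \<Rightarrow> ('x::monoid_add \<Rightarrow>\<^sub>0 'f) \<Rightarrow> ('x \<Rightarrow>\<^sub>0 'f)" where
  "fscale c p \<equiv> Poly_Mapping.single 0 c * p"

interpretation fs: vector_space "fscale :: 'f::field \<Rightarrow> ('x::monoid_add \<Rightarrow>\<^sub>0 'f) \<Rightarrow> _"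
  by standard (simp_all add: distrib_left distrib_right single_add mult_single flip: mult.assoc)

lemma poly_mapping_sum_single: "p = (\<Sum>k\<in>Poly_Mapping.keys p. Poly_Mapping.single k (Poly_Mapping.lookup p k))"
proof (rule poly_mapping_eqI)
  fix k
  show "Poly_Mapping.lookup p k =
      Poly_Mapping.lookup (\<Sum>k\<in>Poly_Mapping.keys p. Poly_Mapping.single k (Poly_Mapping.lookup p k)) k"
    by (cases "k \<in> Poly_Mapping.keys p")
      (auto simp: lookup_sum lookup_single when_def in_keys_iff)
qed

text \<open>Scalars sit on the empty word, the neutral element, so they are central although words
  do not commute.\<close>

lemma fscale_commute: "p * Poly_Mapping.single 0 c = fscale c p"
  for p :: "'x::monoid_add \<Rightarrow>\<^sub>0 'f::field"
proof -
  have "q * Poly_Mapping.single 0 c = fscale c q" if "q = Poly_Mapping.single k a" for k a q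
    using that by (simp add: mult_single mult.commute)
  then show ?thesis
    by (subst (1 2) poly_mapping_sum_single) (simp add: sum_distrib_left sum_distrib_right mult_single mult.commute)
qed

lemma mult_fscale: "p * fscale c q = fscale c (p * q)"
  for p q :: "'x::monoid_add \<Rightarrow>\<^sub>0 'f::field"
  by (metis fscale_commute mult.assoc)

section \<open>Reduction to algebras on a type\<close>

locale leavitt_quotient = wf_digraph G
  for G :: "('v, 'e) pre_digraph" +
  fixes I :: "(('v, 'e) lpa_gen free_word \<Rightarrow>\<^sub>0 'f::field) set set"
  assumes row_finite: "row_finite G"
    and ideal_I: "alg_ideal (leavitt_path_alg G) I"
    and findim: "finite_dimensional (alg_quotient (leavitt_path_alg G) I)"
begin

abbreviation "FA \<equiv> free_alg (lpa_gens G) :: ('f, ('v, 'e) lpa_gen free_word \<Rightarrow>\<^sub>0 'f) alg"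
abbreviation "L \<equiv> leavitt_path_alg G :: ('f, (('v, 'e) lpa_gen free_word \<Rightarrow>\<^sub>0 'f) set) alg"

section \<open>The preimage of the ideal in the free algebra\<close>

definition S where "S = alg_carrier FA"
definition K0 where "K0 = alg_ideal_gen FA (lpa_rels G)"
definition coset where "coset = alg_coset FA K0"
definition K where "K = {x \<in> S. coset x \<in> I}"

lemma FA_simps [simp]: "alg_carrier FA = S" "alg_zero FA = 0" "alg_add FA = (+)" "alg_mult FA = (*)"
  "alg_scale FA = fscale"
  by (simp_all add: free_alg_def S_def)

lemma in_S: "p \<in> S \<longleftrightarrow> (\<forall>w\<in>Poly_Mapping.keys p. letters w \<noteq> [] \<and> set (letters w) \<subseteq> lpa_gens G)"
  by (simp add: S_def free_alg_def)

lemma S_add: "p \<in> S \<Longrightarrow> q \<in> S \<Longrightarrow> p + q \<in> S"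
  using Poly_Mapping.keys_add[of p q] by (auto simp: in_S)

lemma S_mult: "p \<in> S \<Longrightarrow> q \<in> S \<Longrightarrow> p * q \<in> S"
  using Poly_Mapping.keys_mult[of p q] by (fastforce simp: in_S plus_free_word_def)

lemma S_scale: "p \<in> S \<Longrightarrow> fscale c p \<in> S"
  using Poly_Mapping.keys_mult[of "Poly_Mapping.single 0 c" p]
  by (fastforce simp: in_S plus_free_word_def zero_free_word_def split: if_splits)

lemma subspace_S: "fs.subspace S"
  by (intro fs.subspaceI S_add S_scale) (simp_all add: in_S)

lemma letter_S: "g \<in> lpa_gens G \<Longrightarrow> letter g \<in> S"
  by (simp add: in_S letter_def)

lemma gens: "v \<in> verts G \<Longrightarrow> Vtx v \<in> lpa_gens G" "e \<in> arcs G \<Longrightarrow> Arc e \<in> lpa_gens G"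
  "e \<in> arcs G \<Longrightarrow> Ghost e \<in> lpa_gens G"
  by (auto simp: lpa_gens_def)

lemma rels_S: "lpa_rels G \<subseteq> S"
proof -
  have "(\<Sum>e\<in>out_arcs G v. letter (Arc e) * letter (Ghost e)) \<in> S" for v
    by (intro fs.subspace_sum[OF subspace_S] S_mult letter_S gens) auto
  note this fs.subspace_diff[OF subspace_S] S_mult letter_S gens fs.subspace_0[OF subspace_S]
  then show ?thesis unfolding lpa_rels_def by (auto simp del: FA_simps)
qed

lemma ideal_K0: "alg_ideal FA K0"
  unfolding K0_def
proof (rule alg_ideal_gen_ideal)
  show "alg_ideal FA (alg_carrier FA)"
    using subspace_S S_mult by (simp add: alg_ideal_def alg_subspace_def fs.subspace_def)
qed (simp add: rels_S)

lemma rels_K0: "lpa_rels G \<subseteq> K0"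
  by (auto simp: K0_def alg_ideal_gen_def)

lemma K0: "fs.subspace K0" "K0 \<subseteq> S" "p \<in> S \<Longrightarrow> x \<in> K0 \<Longrightarrow> p * x \<in> K0"
  "p \<in> S \<Longrightarrow> x \<in> K0 \<Longrightarrow> x * p \<in> K0"
  using ideal_K0 by (auto simp: alg_ideal_def alg_subspace_def fs.subspace_def)

lemma mem_coset: "x \<in> coset p \<longleftrightarrow> x - p \<in> K0"
  by (auto simp: coset_def alg_coset_def intro!: exI[of _ "x - p"])

lemma coset_eqI: "p - q \<in> K0 \<Longrightarrow> coset p = coset q"
proof (rule set_eqI)
  fix x assume pq: "p - q \<in> K0"
  have "x - q = (x - p) + (p - q)" "x - p = (x - q) - (p - q)" by simp_all
  then show "x \<in> coset p \<longleftrightarrow> x \<in> coset q"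
    using fs.subspace_add[OF K0(1) _ pq] fs.subspace_diff[OF K0(1) _ pq] unfolding mem_coset by metis
qed

lemma coset_self: "p \<in> coset p"
  using fs.subspace_0[OF K0(1)] by (simp add: mem_coset)

lemma coset_S: "p \<in> S \<Longrightarrow> x \<in> coset p \<Longrightarrow> x \<in> S"
  using fs.subspace_add[OF subspace_S, of "x - p" p] K0(2) by (auto simp: mem_coset)

text \<open>Well-definedness of the operations on cosets, through which the unions in
  \<open>alg_quotient\<close> collapse.\<close>

lemma L_simps:
  "alg_carrier L = coset ` S" "alg_zero L = coset 0"
  "p \<in> S \<Longrightarrow> q \<in> S \<Longrightarrow> alg_add L (coset p) (coset q) = coset (p + q)"
  "p \<in> S \<Longrightarrow> q \<in> S \<Longrightarrow> alg_mult L (coset p) (coset q) = coset (p * q)"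
  "p \<in> S \<Longrightarrow> alg_scale L c (coset p) = coset (fscale c p)"
proof -
  have ne: "coset p \<noteq> {}" for p using coset_self by blast
  note L = leavitt_path_alg_def alg_quotient_def alg.select_convs FA_simps
  show "alg_carrier L = coset ` S" "alg_zero L = coset 0"
    by (simp_all add: leavitt_path_alg_def alg_quotient_def coset_def K0_def)
  show "alg_add L (coset p) (coset q) = coset (p + q)" if "p \<in> S" "q \<in> S"
  proof -
    have "coset (a + b) = coset (p + q)" if "a \<in> coset p" "b \<in> coset q" for a b
    proof (rule coset_eqI)
      have "a + b - (p + q) = (a - p) + (b - q)" by simp
      then show "a + b - (p + q) \<in> K0"
        using fs.subspace_add[OF K0(1)] that unfolding mem_coset by metis
    qed
    then show ?thesis unfolding L coset_def[symmetric] K0_def[symmetric]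
      by (intro UN_constant_value[OF ne])
  qed
  show "alg_mult L (coset p) (coset q) = coset (p * q)" if pq: "p \<in> S" "q \<in> S"
  proof -
    have "coset (a * b) = coset (p * q)" if ab: "a \<in> coset p" "b \<in> coset q" for a b
    proof (rule coset_eqI)
      have "a * b - p * q = (a - p) * b + p * (b - q)" by (simp add: algebra_simps)
      then show "a * b - p * q \<in> K0"
        using fs.subspace_add[OF K0(1)] K0(3,4) ab pq coset_S[OF pq(2) ab(2)]
        unfolding mem_coset by metis
    qed
    then show ?thesis unfolding L coset_def[symmetric] K0_def[symmetric]
      by (intro UN_constant_value[OF ne])
  qed
  show "alg_scale L c (coset p) = coset (fscale c p)" if "p \<in> S"
  proof -
    have "coset (fscale c a) = coset (fscale c p)" if "a \<in> coset p" for a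
    proof (rule coset_eqI)
      show "fscale c a - fscale c p \<in> K0"
        using fs.subspace_scale[OF K0(1)] that unfolding mem_coset by (metis right_diff_distrib)
    qed
    then show ?thesis unfolding L coset_def[symmetric] K0_def[symmetric]
      by (intro UN_constant_value[OF ne])
  qed
qed

lemma I_props: "I \<subseteq> coset ` S" "coset 0 \<in> I"
  "\<lbrakk>X \<in> I; Y \<in> I\<rbrakk> \<Longrightarrow> alg_add L X Y \<in> I" "X \<in> I \<Longrightarrow> alg_scale L c X \<in> I"
  "\<lbrakk>A \<in> coset ` S; X \<in> I\<rbrakk> \<Longrightarrow> alg_mult L A X \<in> I" "\<lbrakk>A \<in> coset ` S; X \<in> I\<rbrakk> \<Longrightarrow> alg_mult L X A \<in> I"
  using ideal_I by (auto simp: alg_ideal_def alg_subspace_def L_simps(1,2))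

lemma subspace_K: "fs.subspace K"
proof (rule fs.subspaceI)
  show "0 \<in> K" using I_props(2) fs.subspace_0[OF subspace_S] by (simp add: K_def)
  show "x + y \<in> K" if "x \<in> K" "y \<in> K" for x y
    using that I_props(3)[of "coset x" "coset y"] L_simps(3)[of x y] S_add by (simp add: K_def)
  show "fscale c x \<in> K" if "x \<in> K" for c x
    using that I_props(4)[of "coset x" c] L_simps(5)[of x c] S_scale by (simp add: K_def)
qed

lemma K_mult: "p \<in> S \<Longrightarrow> x \<in> K \<Longrightarrow> p * x \<in> K" "p \<in> S \<Longrightarrow> x \<in> K \<Longrightarrow> x * p \<in> K"
  using I_props(5)[of "coset p" "coset x"] I_props(6)[of "coset p" "coset x"]
    L_simps(4)[of x p] L_simps(4)[of p x] S_mult by (simp_all add: K_def)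

lemma K0_K: "K0 \<subseteq> K"
proof
  fix x assume x: "x \<in> K0"
  then have "coset x = coset 0" by (intro coset_eqI) simp
  then show "x \<in> K" using I_props(2) K0(2) x by (auto simp: K_def)
qed

lemma K_S: "K \<subseteq> S"
  by (auto simp: K_def)

text \<open>
  \<open>K\<close> is the preimage of \<open>I\<close> in the free algebra. A linear reduction \<open>\<rho>\<close> modulo \<open>K\<close> turns its image
  into a copy of the quotient that shares addition and scalars with the type of the free algebra.
\<close>

definition \<rho> :: "(('v, 'e) lpa_gen free_word \<Rightarrow>\<^sub>0 'f) \<Rightarrow> (('v, 'e) lpa_gen free_word \<Rightarrow>\<^sub>0 'f)" where
  "\<rho> = (SOME \<rho>. Vector_Spaces.linear fscale fscale \<rho> \<and> range \<rho> \<subseteq> S \<and> (\<forall>x\<in>S. x - \<rho> x \<in> K) \<and> (\<forall>x\<in>K. \<rho> x = 0))"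

lemma \<rho>: "Vector_Spaces.linear fscale fscale \<rho>" "\<rho> x \<in> S" "x \<in> S \<Longrightarrow> x - \<rho> x \<in> K" "x \<in> K \<Longrightarrow> \<rho> x = 0"
  using someI_ex[OF fs.exists_reduction[OF subspace_K subspace_S K_S]] unfolding \<rho>_def[symmetric] by auto

lemma \<rho>_add: "\<rho> (x + y) = \<rho> x + \<rho> y" and \<rho>_scale: "\<rho> (fscale c x) = fscale c (\<rho> x)"
  using \<rho>(1) by (simp_all add: Vector_Spaces.linear_iff)

lemma \<rho>_zero: "\<rho> 0 = 0"
  using \<rho>_add[of 0 0] by simp

lemma \<rho>_diff: "\<rho> (x - y) = \<rho> x - \<rho> y"
  using \<rho>_add[of "x - y" y] by simp

lemma \<rho>_sum: "\<rho> (sum f A) = (\<Sum>a\<in>A. \<rho> (f a))"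
  by (induction A rule: infinite_finite_induct) (simp_all add: \<rho>_zero \<rho>_add)

lemma \<rho>_eq_iff: "x \<in> S \<Longrightarrow> y \<in> S \<Longrightarrow> \<rho> x = \<rho> y \<longleftrightarrow> x - y \<in> K"
proof
  assume xy: "x \<in> S" "y \<in> S" "\<rho> x = \<rho> y"
  have "x - y = (x - \<rho> x) - (y - \<rho> y)" using xy by simp
  then show "x - y \<in> K" using fs.subspace_diff[OF subspace_K] \<rho>(3) xy by metis
qed (use \<rho>(4)[of "x - y"] in \<open>simp add: \<rho>_diff\<close>)

lemma \<rho>_\<rho>: "x \<in> S \<Longrightarrow> \<rho> (\<rho> x) = \<rho> x"
  using \<rho>(4)[OF \<rho>(3)] by (simp add: \<rho>_diff)

lemma \<rho>_mult: "x \<in> S \<Longrightarrow> y \<in> S \<Longrightarrow> \<rho> (\<rho> x * y) = \<rho> (x * y)" "x \<in> S \<Longrightarrow> y \<in> S \<Longrightarrow> \<rho> (x * \<rho> y) = \<rho> (x * y)"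
proof -
  assume "x \<in> S" "y \<in> S"
  then show "\<rho> (\<rho> x * y) = \<rho> (x * y)" "\<rho> (x * \<rho> y) = \<rho> (x * y)"
    using \<rho>(4)[OF K_mult(2)[OF _ \<rho>(3), of y x]] \<rho>(4)[OF K_mult(1)[OF _ \<rho>(3), of x y]]
    by (simp_all add: left_diff_distrib right_diff_distrib \<rho>_diff)
qed

text \<open>Reducing the factors too makes the product associative on the whole type.\<close>

definition rmul (infixl "\<odot>" 70) where "x \<odot> y = \<rho> (\<rho> x * \<rho> y)"

lemma \<rho>_hom: "x \<in> S \<Longrightarrow> y \<in> S \<Longrightarrow> \<rho> x \<odot> \<rho> y = \<rho> (x * y)"
  by (simp add: rmul_def \<rho>_\<rho> \<rho>_mult \<rho>(2))

sublocale nonunital_algebra fscale rmul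
proof
  fix x y z :: "('v, 'e) lpa_gen free_word \<Rightarrow>\<^sub>0 'f" and c
  have S: "\<rho> x * \<rho> y \<in> S" "\<rho> y * \<rho> z \<in> S" by (simp_all add: S_mult \<rho>(2))
  show "x \<odot> y \<odot> z = x \<odot> (y \<odot> z)"
    using S by (simp add: rmul_def \<rho>_\<rho> \<rho>_mult \<rho>(2) mult.assoc)
  show "(x + y) \<odot> z = x \<odot> z + y \<odot> z" "x \<odot> (y + z) = x \<odot> y + x \<odot> z"
    by (simp_all add: rmul_def \<rho>_add distrib_left distrib_right)
  show "fscale c x \<odot> y = fscale c (x \<odot> y)" "x \<odot> fscale c y = fscale c (x \<odot> y)"
    by (simp_all add: rmul_def \<rho>_scale mult_fscale mult.assoc)
qed

section \<open>The copy of the quotient\<close>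

definition C where "C = \<rho> ` S"

lemma subspace_C: "fs.subspace C"
  using subspace_S unfolding C_def fs.subspace_def
  by (auto simp flip: \<rho>_add \<rho>_scale intro: image_eqI[of _ _ 0] simp: \<rho>_zero)

lemma rmul_C: "x \<odot> y \<in> C"
  by (simp add: rmul_def C_def S_mult \<rho>(2))

text \<open>Any representative of the coset serves, because \<open>K0\<close> lies in
  \<open>K\<close> and \<open>\<rho>\<close> kills \<open>K\<close>.\<close>

definition \<rho>L where "\<rho>L X = \<rho> (SOME x. x \<in> X)"

lemma \<rho>L: "p \<in> S \<Longrightarrow> \<rho>L (coset p) = \<rho> p"
proof -
  assume p: "p \<in> S"
  have "(SOME x. x \<in> coset p) \<in> coset p" using coset_self by (rule someI)
  then show ?thesis
    unfolding \<rho>L_def using \<rho>_eq_iff coset_S[OF p] p K0_K by (auto simp: mem_coset)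
qed

text \<open>Third isomorphism theorem: dividing \<open>L\<close> by \<open>I\<close> amounts to
  dividing \<open>S\<close> by \<open>K\<close>, and \<open>\<rho>\<close> maps that quotient onto
  \<open>C\<close>.\<close>

lemma C_iso_quotient:
  "alg_iso (\<lambda>y. {X \<in> alg_carrier L. \<rho>L X = y}) (sub_alg C) (alg_quotient L I)"
  and C_iso_quotient_zero: "{X \<in> alg_carrier L. \<rho>L X = 0} = alg_zero (alg_quotient L I)"
proof -
  have S0: "0 \<in> S" using fs.subspace_0[OF subspace_S] .
  have closed: "alg_closed L"
    using S0 S_add S_mult S_scale by (auto simp: alg_closed_def L_simps)
  have coset: "alg_coset L I X = {Y \<in> alg_carrier L. \<rho>L Y = \<rho>L X}" if "X \<in> alg_carrier L" for X
  proof -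
    obtain p where p: "p \<in> S" "X = coset p" using \<open>X \<in> alg_carrier L\<close> by (auto simp: L_simps)
    show ?thesis
    proof (intro equalityI subsetI)
      fix Y assume "Y \<in> alg_coset L I X"
      then obtain Z where Z: "Z \<in> I" "Y = alg_add L X Z" by (auto simp: alg_coset_def)
      then obtain k where k: "k \<in> K" "Z = coset k" using I_props(1) by (auto simp: K_def)
      then have "Y = coset (p + k)" using Z p K_S L_simps(3) by auto
      then show "Y \<in> {Y \<in> alg_carrier L. \<rho>L Y = \<rho>L X}"
        using p k K_S S_add[of p k] by (auto simp: \<rho>L L_simps(1) \<rho>_add \<rho>(4))
    next
      fix Y assume "Y \<in> {Y \<in> alg_carrier L. \<rho>L Y = \<rho>L X}"
      then obtain q where q: "q \<in> S" "Y = coset q" "\<rho> q = \<rho> p" using p by (auto simp: \<rho>L L_simps(1))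
      then have k: "q - p \<in> K" using \<rho>_eq_iff p by simp
      then have "Y = alg_add L X (coset (q - p))" using L_simps(3)[of p "q - p"] p q K_S by auto
      then show "Y \<in> alg_coset L I X" using k by (auto simp: alg_coset_def K_def)
    qed
  qed
  have add: "\<rho>L (alg_add L X Y) = alg_add (sub_alg C) (\<rho>L X) (\<rho>L Y)"
    if "X \<in> alg_carrier L" "Y \<in> alg_carrier L" for X Y
    using that by (auto simp: L_simps \<rho>L S_add \<rho>_add)
  have mult: "\<rho>L (alg_mult L X Y) = alg_mult (sub_alg C) (\<rho>L X) (\<rho>L Y)"
    if "X \<in> alg_carrier L" "Y \<in> alg_carrier L" for X Y
    using that by (auto simp: L_simps \<rho>L S_mult \<rho>_hom)
  have scale: "\<rho>L (alg_scale L c X) = alg_scale (sub_alg C) c (\<rho>L X)" if "X \<in> alg_carrier L" for c X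
    using that by (auto simp: L_simps \<rho>L S_scale \<rho>_scale)
  have onto: "\<rho>L ` alg_carrier L = alg_carrier (sub_alg C)"
    by (auto simp: L_simps(1) C_def \<rho>L image_image)
  note fibres = quotient_fibres[where h = \<rho>L, OF closed coset add mult scale onto]
  show "alg_iso (\<lambda>y. {X \<in> alg_carrier L. \<rho>L X = y}) (sub_alg C) (alg_quotient L I)"
    by (rule fibres(1))
  show "{X \<in> alg_carrier L. \<rho>L X = 0} = alg_zero (alg_quotient L I)"
    using fibres(2) \<rho>L[OF S0] by (simp add: L_simps(2) \<rho>_zero)
qed

text \<open>A finite spanning set of the quotient is pulled back to \<open>B\<close>; the image of
  \<open>fs.span B\<close> is a subspace containing it, hence everything.\<close>

lemma finite_spanning: "\<exists>B. finite B \<and> C \<subseteq> fs.span B"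
proof -
  let ?Q = "alg_quotient L I"
  obtain f where f: "alg_iso f (sub_alg C) ?Q" and zero: "f 0 = alg_zero ?Q"
    using C_iso_quotient C_iso_quotient_zero by blast
  obtain U where U: "finite U" "U \<subseteq> alg_carrier ?Q" "alg_span ?Q U = alg_carrier ?Q"
    using findim by (auto simp: finite_dimensional_def)
  have bij: "bij_betw f C (alg_carrier ?Q)" using alg_isoD(1)[OF f] by simp
  obtain B where B: "B \<subseteq> C" "finite B" "U = f ` B"
    using U bij finite_subset_image[of U f C] by (auto simp: bij_betw_def)
  have BC: "fs.span B \<subseteq> C" using fs.span_minimal[OF B(1) subspace_C] .
  have add: "f (x + y) = alg_add ?Q (f x) (f y)" if "x \<in> C" "y \<in> C" for x y
    using alg_isoD(2)[OF f] that by simp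
  have scale: "f (fscale c x) = alg_scale ?Q c (f x)" if "x \<in> C" for c x
    using alg_isoD(4)[OF f] that by simp
  have "alg_subspace ?Q (f ` fs.span B)"
    unfolding alg_subspace_def
  proof (intro conjI ballI allI)
    show "f ` fs.span B \<subseteq> alg_carrier ?Q" using BC bij by (auto simp: bij_betw_def)
    show "alg_zero ?Q \<in> f ` fs.span B" using fs.span_zero zero by (metis imageI)
    fix x y c assume "x \<in> f ` fs.span B" "y \<in> f ` fs.span B"
    then obtain a b where ab: "a \<in> fs.span B" "b \<in> fs.span B" "x = f a" "y = f b" by blast
    then have "alg_add ?Q x y = f (a + b)" using add BC by auto
    then show "alg_add ?Q x y \<in> f ` fs.span B" using ab fs.span_add by blast
  next
    fix x c assume "x \<in> f ` fs.span B"
    then obtain a where a: "a \<in> fs.span B" "x = f a" by blast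
    then have "alg_scale ?Q c x = f (fscale c a)" using scale BC by auto
    then show "alg_scale ?Q c x \<in> f ` fs.span B" using a fs.span_scale by blast
  qed
  moreover have "U \<subseteq> f ` fs.span B" using B fs.span_superset by blast
  ultimately have "alg_carrier ?Q \<subseteq> f ` fs.span B" using U(3) by (auto simp: alg_span_def)
  then have "f ` C \<subseteq> f ` fs.span B" using bij by (simp add: bij_betw_def)
  then have "f ` C = f ` fs.span B" using BC by blast
  then have "C \<subseteq> fs.span B"
    using inj_on_image_eq_iff[OF bij_betw_imp_inj_on[OF bij] subset_refl BC] by simp
  then show ?thesis using B by blast
qed

definition basis where "basis = (SOME B. finite B \<and> C \<subseteq> fs.span B)"

lemma basis: "finite basis" "C \<subseteq> fs.span basis"
  using someI_ex[OF finite_spanning] by (auto simp: basis_def)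

lemma \<rho>_rel: "x - y \<in> lpa_rels G \<Longrightarrow> \<rho> x = \<rho> y"
  using rels_K0 K0_K \<rho>(4)[of "x - y"] by (auto simp: \<rho>_diff)

lemma \<rho>_letters: "g \<in> lpa_gens G \<Longrightarrow> h \<in> lpa_gens G \<Longrightarrow> \<rho> (letter g) \<odot> \<rho> (letter h) = \<rho> (letter g * letter h)"
  by (simp add: \<rho>_hom letter_S)

text \<open>Elements of \<open>S\<close> are combinations of nonempty words, and words are built by
  adding letters on the left; one-letter words are the base because there is no empty word.\<close>

lemma C_induct:
  assumes W: "fs.subspace W" and gen: "\<And>g. g \<in> lpa_gens G \<Longrightarrow> \<rho> (letter g) \<in> W"
    and mul: "\<And>g x. g \<in> lpa_gens G \<Longrightarrow> x \<in> W \<Longrightarrow> \<rho> (letter g) \<odot> x \<in> W"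
  shows "C \<subseteq> W"
proof -
  have word: "\<rho> (Poly_Mapping.single (Word w) c) \<in> W"
    if "w \<noteq> []" "set w \<subseteq> lpa_gens G" for w and c :: 'f
    using that
  proof (induction w)
    case (Cons g w)
    show ?case
    proof (cases "w = []")
      case True
      have "Poly_Mapping.single (Word [g]) c = fscale c (letter g)"
        by (simp add: letter_def mult_single zero_free_word_def plus_free_word_def)
      then show ?thesis using True gen Cons.prems fs.subspace_scale[OF W] by (simp add: \<rho>_scale)
    next
      case False
      have "Poly_Mapping.single (Word (g # w)) c = letter g * Poly_Mapping.single (Word w) c"
        by (simp add: letter_def mult_single plus_free_word_def)
      moreover have "Poly_Mapping.single (Word w) c \<in> S" using False Cons.prems by (simp add: in_S)
      ultimately have "\<rho> (Poly_Mapping.single (Word (g # w)) c) =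
          \<rho> (letter g) \<odot> \<rho> (Poly_Mapping.single (Word w) c)"
        using Cons.prems by (simp add: \<rho>_hom letter_S)
      then show ?thesis using mul Cons False by simp
    qed
  qed simp
  have "\<rho> p \<in> W" if "p \<in> S" for p
  proof -
    have "\<rho> p = (\<Sum>w\<in>Poly_Mapping.keys p. \<rho> (Poly_Mapping.single w (Poly_Mapping.lookup p w)))"
      by (subst poly_mapping_sum_single) (simp only: \<rho>_sum)
    also have "\<dots> \<in> W"
    proof (rule fs.subspace_sum[OF W])
      fix w assume "w \<in> Poly_Mapping.keys p"
      then show "\<rho> (Poly_Mapping.single w (Poly_Mapping.lookup p w)) \<in> W"
        using that word[of "letters w"] by (cases w) (auto simp: in_S)
    qed
    finally show ?thesis .
  qed
  then show ?thesis by (auto simp: C_def)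
qed

text \<open>Each defining relation lies in \<open>K0\<close>, hence in \<open>K\<close>, so
  \<open>\<rho>\<close> identifies its two sides.\<close>

sublocale leavitt_rep fscale rmul G "\<lambda>g. \<rho> (letter g)" C basis
proof
  show "row_finite G" by (rule row_finite)
  show "fs.subspace C" by (rule subspace_C)
  show "x \<odot> y \<in> C" for x y by (rule rmul_C)
  show "finite basis" "C \<subseteq> fs.span basis" by (fact basis)+
  show "C \<subseteq> W" if "fs.subspace W" "\<And>g. g \<in> lpa_gens G \<Longrightarrow> \<rho> (letter g) \<in> W"
    "\<And>g x. g \<in> lpa_gens G \<Longrightarrow> x \<in> W \<Longrightarrow> \<rho> (letter g) \<odot> x \<in> W" for W
    using that by (rule C_induct)
  note hom = \<rho>_letters[OF gens(1) gens(1)] \<rho>_letters[OF gens(1) gens(2)] \<rho>_letters[OF gens(2) gens(1)]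
    \<rho>_letters[OF gens(1) gens(3)] \<rho>_letters[OF gens(3) gens(1)] \<rho>_letters[OF gens(3) gens(2)]
    \<rho>_letters[OF gens(2) gens(3)]
  show "\<rho> (letter (Vtx v)) \<odot> \<rho> (letter (Vtx w)) = (if v = w then \<rho> (letter (Vtx v)) else 0)"
    if "v \<in> verts G" "w \<in> verts G" for v w
  proof -
    have "letter (Vtx v) * letter (Vtx w) - (if v = w then letter (Vtx v) else 0) \<in> lpa_rels G"
      using that unfolding lpa_rels_def by blast
    from \<rho>_rel[OF this] show ?thesis using that by (simp add: hom \<rho>_zero split: if_splits)
  qed
  {
    fix e assume e: "e \<in> arcs G"
    then have "letter (Vtx (tail G e)) * letter (Arc e) - letter (Arc e) \<in> lpa_rels G"
      "letter (Arc e) * letter (Vtx (head G e)) - letter (Arc e) \<in> lpa_rels G"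
      "letter (Vtx (head G e)) * letter (Ghost e) - letter (Ghost e) \<in> lpa_rels G"
      "letter (Ghost e) * letter (Vtx (tail G e)) - letter (Ghost e) \<in> lpa_rels G"
      unfolding lpa_rels_def by blast+
    from this[THEN \<rho>_rel] show "\<rho> (letter (Vtx (tail G e))) \<odot> \<rho> (letter (Arc e)) = \<rho> (letter (Arc e))"
      "\<rho> (letter (Arc e)) \<odot> \<rho> (letter (Vtx (head G e))) = \<rho> (letter (Arc e))"
      "\<rho> (letter (Vtx (head G e))) \<odot> \<rho> (letter (Ghost e)) = \<rho> (letter (Ghost e))"
      "\<rho> (letter (Ghost e)) \<odot> \<rho> (letter (Vtx (tail G e))) = \<rho> (letter (Ghost e))"
      using e by (simp_all add: hom)
  }
  show "\<rho> (letter (Ghost e)) \<odot> \<rho> (letter (Arc f)) = (if e = f then \<rho> (letter (Vtx (head G e))) else 0)"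
    if "e \<in> arcs G" "f \<in> arcs G" for e f
  proof -
    have "letter (Ghost e) * letter (Arc f) - (if e = f then letter (Vtx (head G e)) else 0) \<in> lpa_rels G"
      using that unfolding lpa_rels_def by blast
    from \<rho>_rel[OF this] show ?thesis using that by (simp add: hom \<rho>_zero split: if_splits)
  qed
  show "\<rho> (letter (Vtx v)) = (\<Sum>e\<in>out_arcs G v. \<rho> (letter (Arc e)) \<odot> \<rho> (letter (Ghost e)))"
    if "v \<in> verts G" "out_arcs G v \<noteq> {}" for v
  proof -
    have "letter (Vtx v) - (\<Sum>e\<in>out_arcs G v. letter (Arc e) * letter (Ghost e)) \<in> lpa_rels G"
      using that unfolding lpa_rels_def by blast
    then have "\<rho> (letter (Vtx v)) = \<rho> (\<Sum>e\<in>out_arcs G v. letter (Arc e) * letter (Ghost e))"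
      by (rule \<rho>_rel)
    also have "\<dots> = (\<Sum>e\<in>out_arcs G v. \<rho> (letter (Arc e)) \<odot> \<rho> (letter (Ghost e)))"
      unfolding \<rho>_sum by (intro sum.cong refl) (simp add: hom)
    finally show ?thesis .
  qed
qed

lemma alg_closed_C: "alg_closed (sub_alg C)"
  using subspace_C rmul_C by (simp add: alg_closed_def fs.subspace_def)

end

theorem theorem6p2:
  fixes \<Gamma> :: "('v, 'e) pre_digraph"
    and L :: "('f :: field, (('v, 'e) lpa_gen free_word \<Rightarrow>\<^sub>0 'f) set) alg"
    and I :: "(('v, 'e) lpa_gen free_word \<Rightarrow>\<^sub>0 'f) set set"
  assumes "wf_digraph \<Gamma>"
    and "row_finite \<Gamma>"
    and "L = leavitt_path_alg \<Gamma>"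
    and "alg_ideal L I"
    and "finite_dimensional (alg_quotient L I)"
  shows "\<exists>(m :: nat) (n :: nat \<Rightarrow> nat) (P :: nat \<Rightarrow> 'f poly).
           (\<forall>k<m. n k > 0 \<and> degree (P k) > 0 \<and> poly (P k) 0 = 1) \<and>
           alg_isomorphic (alg_quotient L I)
             (alg_direct_sum m (\<lambda>k. matrix_alg (n k) (poly_quotient_alg (P k))))"
proof -
  interpret leavitt_quotient \<Gamma> I
    using assms by (simp add: leavitt_quotient_def leavitt_quotient_axioms_def)
  obtain m n P \<Phi> where "\<forall>k<m. n k > 0 \<and> degree (P k) > 0 \<and> poly (P k) 0 = (1::'f)"
    and \<Phi>: "alg_iso \<Phi> (sub_alg C) (alg_direct_sum m (\<lambda>k. matrix_alg (n k) (poly_quotient_alg (P k))))"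
    using sub_alg_C_iso by blast
  moreover have "alg_isomorphic (alg_quotient L I)
      (alg_direct_sum m (\<lambda>k. matrix_alg (n k) (poly_quotient_alg (P k))))"
    using alg_isomorphic_from_common[OF alg_closed_C C_iso_quotient \<Phi>] by (simp add: assms(3))
  ultimately show ?thesis by blast
qed

end
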